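(* For any integers $k \ge 5$ and $n \ge 2k + (\lceil k/2 \rceil +1) \lceil k/2 \rceil -2$, let $c=\left(\frac{1}{2} \left\lceil \frac{k}{2} \right\rceil + \frac{3}{2} \right) k -2$ and $C= 2k^2-6k+\frac32-\left\lceil\frac{k}{2}\right\rceil \left(k- \frac{1}{2} \left\lceil\frac{k}{2}\right\rceil -1\right)$. Then \[ \left( \frac{3}{2} + \frac{1}{2} \left\lceil \frac{k}{2} \right\rceil \right)n - c \le sat(n, \mathcal{R}_{\min}(K_3, \mathcal{T}_k)) \le \left( \frac{3}{2} + \frac{1}{2} \left\lceil \frac{k}{2} \right\rceil \right)n + C. \]
   Context: All graphs are finite, simple. For an integer $k$, $\mathcal{T}_k$ denotes the family of all trees on $k$ vertices. A graph $G$ is $(K_3,\mathcal{T}_k)$-Ramsey-minimal if every $2$-coloring $c:E(G)\to\{\text{red},\text{blue}\}$ of the edges of $G$ contains either a red $K_3$ or a blue tree $T\in\mathcal{T}_k$ (a subgraph isomorphic to some tree on $k$ vertices all of whose edges are blue), but no proper subgraph of $G$ has this property. $\mathcal{R}_{\min}(K_3,\mathcal{T}_k)$ is the family of all $(K_3,\mathcal{T}_k)$-Ramsey-minimal graphs. A graph $G$ is $\mathcal{R}_{\min}(K_3,\mathcal{T}_k)$-saturated if no member of $\mathcal{R}_{\min}(K_3,\mathcal{T}_k)$ is a subgraph of $G$, but for every edge $e$ of the complement of $G$, some member of $\mathcal{R}_{\min}(K_3,\mathcal{T}_k)$ is a subgraph of $G+e$. $sat(n,\mathcal{R}_{\min}(K_3,\mathcal{T}_k))$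 is the minimum number of edges of an $\mathcal{R}_{\min}(K_3,\mathcal{T}_k)$-saturated graph on $n$ vertices. *)

theory Defs
  imports Complex_Main
begin

datatype 'a graph = Graph (verts: "'a set") (edges: "'a set set")

definition simple_graph :: "'a graph \<Rightarrow> bool" where
  "simple_graph G \<longleftrightarrow>
     finite (verts G) \<and> (\<forall>e\<in>edges G. \<exists>u\<in>verts G. \<exists>v\<in>verts G. u \<noteq> v \<and> e = {u, v})"

definition subgraph :: "'a graph \<Rightarrow> 'a graph \<Rightarrow> bool" where
  "subgraph H G \<longleftrightarrow> simple_graph H \<and> verts H \<subseteq> verts G \<and> edges H \<subseteq> edges G"

definition isomorphic :: "'a graph \<Rightarrow> 'b graph \<Rightarrow> bool" where
  "isomorphic G H \<longleftrightarrow>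
     (\<exists>f. bij_betw f (verts G) (verts H) \<and>
        (\<forall>u\<in>verts G. \<forall>v\<in>verts G. {u, v} \<in> edges G \<longleftrightarrow> {f u, f v} \<in> edges H))"

text \<open>Containment as a not necessarily induced subgraph, up to isomorphism.\<close>

definition contains :: "'a graph \<Rightarrow> 'b graph \<Rightarrow> bool" where
  "contains G H \<longleftrightarrow> (\<exists>S. subgraph S G \<and> isomorphic S H)"

definition connected_graph :: "'a graph \<Rightarrow> bool" where
  "connected_graph G \<longleftrightarrow>
     verts G \<noteq> {} \<and> (\<forall>u\<in>verts G. \<forall>v\<in>verts G. (\<lambda>x y. {x, y} \<in> edges G)\<^sup>*\<^sup>* u v)"

definition is_cycle :: "'a graph \<Rightarrow> 'a list \<Rightarrow> bool" where
  "is_cycle G vs \<longleftrightarrow>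
     length vs \<ge> 3 \<and> distinct vs \<and> set vs \<subseteq> verts G \<and>
     (\<forall>i. Suc i < length vs \<longrightarrow> {vs ! i, vs ! Suc i} \<in> edges G) \<and> {last vs, hd vs} \<in> edges G"

definition tree :: "'a graph \<Rightarrow> bool" where
  "tree G \<longleftrightarrow> simple_graph G \<and> connected_graph G \<and> (\<nexists>vs. is_cycle G vs)"

text \<open>Families of graphs consist of graphs with vertices in \<^typ>\<open>nat\<close>; since this type is
  infinite, every isomorphism class of finite graphs is represented.\<close>

definition trees :: "nat \<Rightarrow> nat graph set" where
  "trees k = {T. tree T \<and> card (verts T) = k}"

definition complete_graph :: "nat \<Rightarrow> nat graph" where
  "complete_graph m = Graph {..<m} {{u, v} | u v. u < m \<and> v < m \<and> u \<noteq> v}"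

datatype colour = Red | Blue

definition colour_class :: "'a graph \<Rightarrow> ('a set \<Rightarrow> colour) \<Rightarrow> colour \<Rightarrow> 'a graph" where
  "colour_class G c x = Graph (verts G) {e \<in> edges G. c e = x}"

text \<open>A 2-colouring is a total function on vertex sets, of which only the values on the edges
  of the graph matter.\<close>

definition ramsey :: "'b graph \<Rightarrow> 'c graph set \<Rightarrow> 'a graph \<Rightarrow> bool" where
  "ramsey H \<T> G \<longleftrightarrow>
     (\<forall>c. contains (colour_class G c Red) H \<or> (\<exists>T\<in>\<T>. contains (colour_class G c Blue) T))"

definition ramsey_minimal :: "'b graph \<Rightarrow> 'c graph set \<Rightarrow> 'a graph \<Rightarrow> bool" where
  "ramsey_minimal H \<T> G \<longleftrightarrow>
     simple_graph G \<and> ramsey H \<T> G \<and> (\<forall>G'. subgraph G' G \<and> G' \<noteq> G \<longrightarrow> \<not> ramsey H \<T> G')"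

definition R_min :: "'b graph \<Rightarrow> 'c graph set \<Rightarrow> nat graph set" where
  "R_min H \<T> = {G. ramsey_minimal H \<T> G}"

definition complement_edges :: "'a graph \<Rightarrow> 'a set set" where
  "complement_edges G = {{u, v} | u v. u \<in> verts G \<and> v \<in> verts G \<and> u \<noteq> v \<and> {u, v} \<notin> edges G}"

definition add_edge :: "'a graph \<Rightarrow> 'a set \<Rightarrow> 'a graph" where
  "add_edge G e = Graph (verts G) (insert e (edges G))"

definition saturated :: "'b graph set \<Rightarrow> 'a graph \<Rightarrow> bool" where
  "saturated \<F> G \<longleftrightarrow>
     simple_graph G \<and> (\<forall>F\<in>\<F>. \<not> contains G F) \<and>
     (\<forall>e\<in>complement_edges G. \<exists>F\<in>\<F>. contains (add_edge G e) F)"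

text \<open>The minimum is over a nonempty set whenever every member of the family has an edge: an
  edge-maximal graph on \<open>n\<close> vertices containing no member of the family is saturated.\<close>

definition sat :: "nat \<Rightarrow> 'b graph set \<Rightarrow> nat" where
  "sat n \<F> =
     (LEAST m. \<exists>G :: nat graph. card (verts G) = n \<and> saturated \<F> G \<and> card (edges G) = m)"

end

theory Submission
  imports Defs
begin

text \<open>A graph is not Ramsey for \<open>(K\<^sub>3, T\<^sub>k)\<close> iff its vertices can be partitioned into classes with
  fewer than \<open>k\<close> elements such that every triangle has two vertices in one class: take the blue
  components as classes, and conversely colour an edge blue iff it lies within a class.

  In a saturated graph the classes of any such partition are cliques, and non-adjacent vertices of
  different classes have a common neighbour along red edges, i.e. edges between classes; moreover
  red is triangle-free. In a coarsest partition any two classes have together at least \<open>k\<close>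
  vertices, so all classes but one have at least \<open>k / 2\<close>, which bounds the number of blue edges. One
  can also arrange that all red degrees are at least \<open>2\<close>, and then there are about \<open>2 n\<close> red edges
  as in a graph of diameter \<open>2\<close> and minimum degree \<open>2\<close>.

  For the upper bound, cliques of about \<open>k / 2\<close> vertices are joined to two hubs inside a complete
  graph on \<open>2 k - 2\<close> vertices minus an edge. A single exceptional vertex makes the partition of this
  graph unique, so adding any edge creates a triangle that no partition can handle.\<close>

subsection \<open>Ramsey graphs and vertex partitions\<close>

text \<open>Classes are the fibres of a labelling \<open>f\<close> within \<open>verts G\<close>.
  The label type is left open so that blue components, which are sets of vertices, can serve as
  labels.\<close>

definition good_partition :: "nat \<Rightarrow> 'a graph \<Rightarrow> ('a \<Rightarrow> 'b) \<Rightarrow> bool" where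
  "good_partition k G f \<longleftrightarrow>
     (\<forall>i. card {u \<in> verts G. f u = i} < k) \<and>
     (\<forall>u v w. {u, v} \<in> edges G \<and> {v, w} \<in> edges G \<and> {u, w} \<in> edges G \<longrightarrow>
        f u = f v \<or> f v = f w \<or> f u = f w)"

lemma simple_graph_edgeD:
  assumes "simple_graph G" "{u, v} \<in> edges G"
  shows "u \<in> verts G" "v \<in> verts G" "u \<noteq> v"
  using assms unfolding simple_graph_def by (metis doubleton_eq_iff insert_absorb2)+

lemma simple_graph_edgeE:
  assumes "simple_graph G" "e \<in> edges G"
  obtains u v where "u \<in> verts G" "v \<in> verts G" "u \<noteq> v" "e = {u, v}"
  using assms unfolding simple_graph_def by blast

lemma finite_edges:
  assumes "simple_graph G"
  shows "finite (edges G)"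
proof (rule finite_subset)
  show "edges G \<subseteq> Pow (verts G)"
    using assms unfolding simple_graph_def by fastforce
qed (use assms in \<open>simp add: simple_graph_def\<close>)

lemma subgraph_refl: "simple_graph G \<Longrightarrow> subgraph G G"
  by (simp add: subgraph_def)

lemma isomorphic_refl: "isomorphic G G"
  unfolding isomorphic_def by (rule exI[of _ id]) auto

lemma isomorphic_inverse:
  assumes "isomorphic G H"
  obtains g where "bij_betw g (verts H) (verts G)"
    "\<And>u v. u \<in> verts H \<Longrightarrow> v \<in> verts H \<Longrightarrow> {g u, g v} \<in> edges G \<longleftrightarrow> {u, v} \<in> edges H"
proof -
  obtain f where f: "bij_betw f (verts G) (verts H)"
    "\<And>u v. u \<in> verts G \<Longrightarrow> v \<in> verts G \<Longrightarrow> {u, v} \<in> edges G \<longleftrightarrow> {f u, f v} \<in> edges H"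
    using assms unfolding isomorphic_def by blast
  define g where "g = inv_into (verts G) f"
  have g: "bij_betw g (verts H) (verts G)"
    using f(1) g_def bij_betw_inv_into by blast
  show ?thesis
  proof (rule that[OF g])
    fix u v assume uv: "u \<in> verts H" "v \<in> verts H"
    have "g u \<in> verts G" "g v \<in> verts G"
      using g uv bij_betwE by blast+
    moreover have "f (g u) = u" "f (g v) = v"
      using f(1) g_def uv bij_betw_inv_into_right by fastforce+
    ultimately show "{g u, g v} \<in> edges G \<longleftrightarrow> {u, v} \<in> edges H"
      using f(2) by metis
  qed
qed

lemma edge_complete_graph_iff:
  "{u, v} \<in> edges (complete_graph m) \<longleftrightarrow> u < m \<and> v < m \<and> u \<noteq> v"
  by (auto simp: complete_graph_def doubleton_eq_iff)

lemma contains_triangle_iff: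
  assumes "simple_graph G"
  shows "contains G (complete_graph 3) \<longleftrightarrow>
    (\<exists>u v w. {u, v} \<in> edges G \<and> {v, w} \<in> edges G \<and> {u, w} \<in> edges G)" (is "?l \<longleftrightarrow> ?r")
proof
  assume ?l
  then obtain S where S: "subgraph S G" "isomorphic S (complete_graph 3)"
    unfolding contains_def by blast
  obtain g where g: "\<And>u v. u \<in> verts (complete_graph 3) \<Longrightarrow> v \<in> verts (complete_graph 3) \<Longrightarrow>
      {g u, g v} \<in> edges S \<longleftrightarrow> {u, v} \<in> edges (complete_graph 3)"
    using isomorphic_inverse[OF S(2)] by metis
  have "{g i, g j} \<in> edges G" if "i < 3" "j < 3" "i \<noteq> j" for i j
  proof -
    have "{g i, g j} \<in> edges S"
      using that g[of i j] by (simp add: edge_complete_graph_iff) (simp add: complete_graph_def)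
    then show ?thesis
      using S(1) by (auto simp: subgraph_def)
  qed
  from this[of 0 1] this[of 1 2] this[of 0 2] show ?r
    by auto
next
  assume ?r
  then obtain u v w where uvw: "{u, v} \<in> edges G" "{v, w} \<in> edges G" "{u, w} \<in> edges G"
    by blast
  note D = simple_graph_edgeD[OF assms uvw(1)] simple_graph_edgeD[OF assms uvw(2)]
    simple_graph_edgeD[OF assms uvw(3)]
  define S where "S = Graph {u, v, w} {{u, v}, {v, w}, {u, w}}"
  define h where "h = (\<lambda>x. if x = u then 0 else if x = v then 1 else 2 :: nat)"
  have "subgraph S G"
    using D uvw by (auto simp: subgraph_def S_def simple_graph_def)
  moreover have "isomorphic S (complete_graph 3)"
    unfolding isomorphic_def
  proof (intro exI conjI ballI)
    have "{..<3} = {0, 1, 2 :: nat}"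
      by auto
    then show "bij_betw h (verts S) (verts (complete_graph 3))"
      using D by (auto simp: bij_betw_def S_def complete_graph_def h_def inj_on_def)
    fix x y assume "x \<in> verts S" "y \<in> verts S"
    then have "{x, y} \<in> edges S \<longleftrightarrow> x \<noteq> y"
      using D by (auto simp: S_def doubleton_eq_iff)
    moreover have "{h x, h y} \<in> edges (complete_graph 3) \<longleftrightarrow> h x \<noteq> h y"
      by (auto simp: edge_complete_graph_iff h_def)
    moreover have "h x = h y \<longleftrightarrow> x = y"
      using D \<open>x \<in> verts S\<close> \<open>y \<in> verts S\<close> by (auto simp: h_def S_def)
    ultimately show "{x, y} \<in> edges S \<longleftrightarrow> {h x, h y} \<in> edges (complete_graph 3)"
      by simp
  qed
  ultimately show ?l
    unfolding contains_def by blast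
qed

section \<open>Trees inside connected components\<close>

text \<open>The new vertex \<open>q\<close> has \<open>p\<close> as its only neighbour, whereas a
  vertex on a cycle has two; a cycle avoiding \<open>q\<close> already lies in
  \<open>T\<close>.\<close>

lemma tree_add_leaf:
  assumes "tree T" and p: "p \<in> verts T" and q: "q \<notin> verts T"
  shows "tree (Graph (insert q (verts T)) (insert {p, q} (edges T)))" (is "tree ?T")
proof -
  have sT: "simple_graph T" and cT: "connected_graph T" and aT: "\<nexists>vs. is_cycle T vs"
    using assms(1) by (auto simp: tree_def)
  let ?r = "(\<lambda>x y. {x, y} \<in> edges ?T)\<^sup>*\<^sup>*"
  have mono: "(\<lambda>x y. {x, y} \<in> edges T)\<^sup>*\<^sup>* u v \<Longrightarrow> ?r u v" for u v
    by (erule rtranclp_mono[THEN predicate2D, rotated]) auto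
  have pq: "?r p q" "?r q p"
    by (auto simp: insert_commute intro: r_into_rtranclp)
  have old: "?r u v" if "u \<in> verts T" "v \<in> verts T" for u v
    using cT that mono unfolding connected_graph_def by blast
  have conn: "connected_graph ?T"
    unfolding connected_graph_def
  proof (intro conjI ballI)
    fix u v assume "u \<in> verts ?T" "v \<in> verts ?T"
    then have "?r u p" "?r p v"
      using pq old p by auto
    then show "?r u v"
      by (rule rtranclp_trans)
  qed simp
  have simp_T: "simple_graph ?T"
    using sT p q unfolding simple_graph_def by auto blast
  have qT: "y = p" if "{q, y} \<in> edges ?T" for y
    using that q simple_graph_edgeD(1)[OF sT] by (auto simp: doubleton_eq_iff)
  have "\<not> is_cycle ?T vs" for vs
  proof
    assume cyc: "is_cycle ?T vs"
    define l where "l = length vs"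
    have l: "l \<ge> 3" and d: "distinct vs" and s: "set vs \<subseteq> insert q (verts T)"
      and e: "\<And>i. Suc i < l \<Longrightarrow> {vs ! i, vs ! Suc i} \<in> edges ?T"
      and e': "{last vs, hd vs} \<in> edges ?T"
      using cyc by (auto simp: is_cycle_def l_def)
    have "vs \<noteq> []"
      using l by (auto simp: l_def)
    then have ends: "last vs = vs ! (l - 1)" "hd vs = vs ! 0"
      by (auto simp: l_def last_conv_nth hd_conv_nth)
    show False
    proof (cases "q \<in> set vs")
      case True
      then obtain i where i: "i < l" "vs ! i = q"
        by (auto simp: in_set_conv_nth l_def)
      \<comment> \<open>\<open>a\<close> and \<open>b\<close> are the cyclic predecessor and
        successor of the position of \<open>q\<close>; they differ because a cycle has at least 3
        vertices.\<close>
      define a where "a = (if i = 0 then l - 1 else i - 1)"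
      define b where "b = (if Suc i = l then 0 else Suc i)"
      have "{vs ! a, q} \<in> edges ?T"
        using i e[of "i - 1"] e' unfolding ends a_def by (cases "i = 0") simp_all
      then have "{q, vs ! a} \<in> edges ?T"
        by (simp only: insert_commute)
      moreover have "{q, vs ! b} \<in> edges ?T"
        using i e[of i] e' unfolding ends b_def by (cases "Suc i = l") auto
      ultimately have "vs ! a = vs ! b"
        using qT by metis
      moreover have "a < l" "b < l" "a \<noteq> b"
        using i l by (auto simp: a_def b_def)
      ultimately show False
        using d by (simp add: nth_eq_iff_index_eq l_def)
    next
      case False
      have "is_cycle T vs"
        unfolding is_cycle_def
      proof (intro conjI allI impI)
        show "set vs \<subseteq> verts T"
          using s False by auto
        fix i assume "Suc i < length vs"
        then show "{vs ! i, vs ! Suc i} \<in> edges T"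
          using e[of i] False nth_mem[of i vs] nth_mem[of "Suc i" vs]
          by (auto simp: l_def doubleton_eq_iff)
      next
        have "last vs \<noteq> q" "hd vs \<noteq> q"
          using False \<open>vs \<noteq> []\<close> last_in_set hd_in_set by metis+
        then show "{last vs, hd vs} \<in> edges T"
          using e' by (auto simp: doubleton_eq_iff)
      qed (use l d l_def in auto)
      then show False
        using aT by blast
    qed
  qed
  then show ?thesis
    using conn simp_T by (simp add: tree_def)
qed

lemma rtranclp_crossing:
  assumes "r\<^sup>*\<^sup>* u v" "u \<in> S" "v \<notin> S"
  shows "\<exists>p q. p \<in> S \<and> q \<notin> S \<and> r p q"
  using assms by (induction rule: rtranclp_induct) auto

text \<open>The tree grows from \<open>v\<close> by one leaf at a time: as long as it does not cover
  the component, some edge of \<open>G\<close> leaves its vertex set.\<close>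

lemma subtree_of_component:
  assumes G: "simple_graph G" and v: "v \<in> verts G"
    and "0 < j" "j \<le> card {u \<in> verts G. (\<lambda>x y. {x, y} \<in> edges G)\<^sup>*\<^sup>* v u}"
  shows "\<exists>T. tree T \<and> subgraph T G \<and> card (verts T) = j \<and> v \<in> verts T"
  using assms(3,4)
proof (induction j)
  case (Suc j)
  show ?case
  proof (cases "j = 0")
    case True
    have "tree (Graph {v} {})"
      by (auto simp: tree_def simple_graph_def connected_graph_def is_cycle_def)
    then show ?thesis
      using True v by (intro exI[of _ "Graph {v} {}"]) (auto simp: subgraph_def simple_graph_def)
  next
    case False
    then obtain T where T: "tree T" "subgraph T G" "card (verts T) = j" "v \<in> verts T"
      using Suc by fastforce
    let ?C = "{u \<in> verts G. (\<lambda>x y. {x, y} \<in> edges G)\<^sup>*\<^sup>* v u}"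
    have fin: "finite (verts T)"
      using T(1) by (simp add: tree_def simple_graph_def)
    have "\<not> ?C \<subseteq> verts T"
      using card_mono[OF fin, of ?C] Suc.prems T(3) by auto
    then obtain p q where pq: "p \<in> verts T" "q \<notin> verts T" "{p, q} \<in> edges G"
      using T(4) rtranclp_crossing[of "\<lambda>x y. {x, y} \<in> edges G" v _ "verts T"] by blast
    let ?T = "Graph (insert q (verts T)) (insert {p, q} (edges T))"
    have t: "tree ?T"
      by (rule tree_add_leaf[OF T(1) pq(1,2)])
    moreover have "subgraph ?T G"
      using t T(2) pq simple_graph_edgeD[OF G pq(3)] by (auto simp: subgraph_def tree_def)
    moreover have "card (verts ?T) = Suc j"
      using fin pq T(3) by simp
    ultimately show ?thesis
      using T(4) by (intro exI[of _ ?T]) auto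
  qed
qed simp

section \<open>From partitions to colourings and back\<close>

lemma simple_colour_class: "simple_graph G \<Longrightarrow> simple_graph (colour_class G c x)"
  by (simp add: simple_graph_def colour_class_def)

text \<open>Edges within a class are coloured blue, all others red. A blue tree is connected, so it
  stays in one class and has fewer than \<open>k\<close> vertices; a red triangle would meet three
  classes.\<close>

lemma good_partition_imp_not_ramsey:
  assumes G: "simple_graph G" and f: "good_partition k G f"
  shows "\<not> ramsey (complete_graph 3) (trees k) G"
proof -
  define c where "c = (\<lambda>e. if \<exists>i. \<forall>u\<in>e. f u = i then Blue else Red)"
  have "\<not> contains (colour_class G c Red) (complete_graph 3)"
  proof
    assume "contains (colour_class G c Red) (complete_graph 3)"
    then obtain u v w where
      uvw: "{u, v} \<in> edges G" "{v, w} \<in> edges G" "{u, w} \<in> edges G"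
      and col: "c {u, v} = Red" "c {v, w} = Red" "c {u, w} = Red"
      using contains_triangle_iff[OF simple_colour_class[OF G]] by (auto simp: colour_class_def)
    from uvw f have "f u = f v \<or> f v = f w \<or> f u = f w"
      unfolding good_partition_def by blast
    then show False
      using col by (auto simp: c_def split: if_splits)
  qed
  moreover have "\<not> contains (colour_class G c Blue) T" if T: "T \<in> trees k" for T
  proof
    assume "contains (colour_class G c Blue) T"
    then obtain S where S: "subgraph S (colour_class G c Blue)" "isomorphic S T"
      unfolding contains_def by blast
    obtain g where g: "bij_betw g (verts T) (verts S)"
      "\<And>u v. u \<in> verts T \<Longrightarrow> v \<in> verts T \<Longrightarrow> {g u, g v} \<in> edges S \<longleftrightarrow> {u, v} \<in> edges T"
      using isomorphic_inverse[OF S(2)] by metis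
    have conn: "connected_graph T" and cT: "card (verts T) = k" and sT: "simple_graph T"
      using T by (auto simp: trees_def tree_def)
    have const: "f (g u) = f (g v)" if "(\<lambda>x y. {x, y} \<in> edges T)\<^sup>*\<^sup>* u v" for u v
      using that
    proof (induction rule: rtranclp_induct)
      case (step y z)
      have "{g y, g z} \<in> edges S"
        using simple_graph_edgeD[OF sT step(2)] step(2) g(2) by blast
      then have "c {g y, g z} = Blue"
        using S(1) by (auto simp: subgraph_def colour_class_def)
      then show ?case
        using step.IH by (auto simp: c_def split: if_splits)
    qed simp
    obtain u where u: "u \<in> verts T"
      using conn by (auto simp: connected_graph_def)
    have "verts S \<subseteq> {x \<in> verts G. f x = f (g u)}"
    proof
      fix x assume x: "x \<in> verts S"
      then obtain y where "y \<in> verts T" "x = g y"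
        using g(1) by (auto simp: bij_betw_def)
      moreover have "x \<in> verts G"
        using x S(1) by (auto simp: subgraph_def colour_class_def)
      ultimately show "x \<in> {x \<in> verts G. f x = f (g u)}"
        using const conn u unfolding connected_graph_def by blast
    qed
    then have "card (verts S) \<le> card {x \<in> verts G. f x = f (g u)}"
      using G by (intro card_mono) (auto simp: simple_graph_def)
    moreover have "card (verts S) = k"
      using g(1) cT bij_betw_same_card by fastforce
    ultimately show False
      using f unfolding good_partition_def by (metis leD)
  qed
  ultimately show ?thesis
    unfolding ramsey_def by blast
qed

text \<open>Each vertex is labelled by its blue component. A component with at least
  \<open>k\<close> vertices would contain a blue tree on exactly \<open>k\<close> vertices, and
  every triangle has a blue edge, whose ends share a component.\<close>

lemma not_ramsey_imp_good_partition:
  fixes G :: "nat graph"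
  assumes G: "simple_graph G" and k: "0 < k"
    and "\<not> ramsey (complete_graph 3) (trees k) G"
  shows "\<exists>f :: nat \<Rightarrow> nat set. good_partition k G f"
proof -
  obtain c where no_K3: "\<not> contains (colour_class G c Red) (complete_graph 3)"
    and no_tree: "\<And>T. T \<in> trees k \<Longrightarrow> \<not> contains (colour_class G c Blue) T"
    using assms(3) unfolding ramsey_def by blast
  let ?B = "colour_class G c Blue"
  let ?r = "(\<lambda>x y. {x, y} \<in> edges ?B)\<^sup>*\<^sup>*"
  have sym: "?r u v" if "?r v u" for u v
    using that
  proof (induction rule: rtranclp_induct)
    case (step y z)
    then have "{z, y} \<in> edges ?B"
      by (simp add: insert_commute)
    then show ?case
      using step.IH by (rule converse_rtranclp_into_rtranclp)
  qed simp
  define f where "f = (\<lambda>u. {v \<in> verts G. ?r u v})"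
  have f_eq: "f u = f v" if "?r u v" for u v
    using that sym rtranclp_trans[of "\<lambda>x y. {x, y} \<in> edges ?B"] unfolding f_def by blast
  have "card {u \<in> verts G. f u = i} < k" for i
  proof (rule ccontr)
    assume big: "\<not> card {u \<in> verts G. f u = i} < k"
    then have "{u \<in> verts G. f u = i} \<noteq> {}"
      using k by force
    then obtain v where v: "v \<in> verts G" "f v = i"
      by blast
    have "{u \<in> verts G. f u = i} \<subseteq> f v"
      using v by (auto simp: f_def)
    then have "k \<le> card (f v)"
      using big card_mono[of "f v" "{u \<in> verts G. f u = i}"] G
      by (auto simp: f_def simple_graph_def)
    then have "\<exists>T. tree T \<and> subgraph T ?B \<and> card (verts T) = k \<and> v \<in> verts T"
      using subtree_of_component[OF simple_colour_class[OF G, of c Blue], of v k] v(1) k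
      by (simp add: f_def colour_class_def)
    then show False
      using no_tree isomorphic_refl unfolding contains_def trees_def by blast
  qed
  moreover have "f u = f v \<or> f v = f w \<or> f u = f w"
    if "{u, v} \<in> edges G" "{v, w} \<in> edges G" "{u, w} \<in> edges G" for u v w
  proof -
    have "\<not> (c {u, v} = Red \<and> c {v, w} = Red \<and> c {u, w} = Red)"
      using no_K3 that unfolding contains_triangle_iff[OF simple_colour_class[OF G]]
      by (auto simp: colour_class_def)
    then have "c {u, v} = Blue \<or> c {v, w} = Blue \<or> c {u, w} = Blue"
      by (metis (full_types) colour.exhaust)
    then show ?thesis
    proof (elim disjE)
      assume "c {u, v} = Blue"
      then have "f u = f v"
        using that by (intro f_eq r_into_rtranclp) (simp add: colour_class_def)
      then show ?thesis ..
    next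
      assume "c {v, w} = Blue"
      then have "f v = f w"
        using that by (intro f_eq r_into_rtranclp) (simp add: colour_class_def)
      then show ?thesis
        by simp
    next
      assume "c {u, w} = Blue"
      then have "f u = f w"
        using that by (intro f_eq r_into_rtranclp) (simp add: colour_class_def)
      then show ?thesis
        by simp
    qed
  qed
  ultimately show ?thesis
    unfolding good_partition_def by blast
qed

text \<open>Each label is replaced by the least number carrying it, so that all partitions can be
  compared within the single type \<open>nat => nat\<close>.\<close>

lemma good_partition_nat:
  fixes G :: "nat graph"
  assumes "good_partition k G f"
  shows "\<exists>f' :: nat \<Rightarrow> nat. good_partition k G f'"
proof -
  define f' where "f' = (\<lambda>u. LEAST v. f v = f u)"
  have f: "f (f' u) = f u" for u
    unfolding f'_def by (rule LeastI[of _ u]) simp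
  have eq: "f' u = f' v \<longleftrightarrow> f u = f v" for u v
  proof
    assume "f' u = f' v"
    then show "f u = f v"
      using f[of u] f[of v] by simp
  qed (simp add: f'_def)
  have "card {u \<in> verts G. f' u = i} < k" for i
  proof (cases "\<exists>v. f' v = i")
    case True
    then obtain v where "i = f' v"
      by metis
    then show ?thesis
      using assms by (simp add: eq good_partition_def)
  next
    case False
    then have "{u \<in> verts G. f' u = i} = {}"
      by simp
    moreover have "0 < k"
      using assms unfolding good_partition_def by (metis gr_zeroI less_nat_zero_code)
    ultimately show ?thesis
      by (simp only: card.empty)
  qed
  moreover have "f' u = f' v \<or> f' v = f' w \<or> f' u = f' w"
    if "{u, v} \<in> edges G" "{v, w} \<in> edges G" "{u, w} \<in> edges G" for u v w
    using assms that unfolding good_partition_def eq by blast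
  ultimately show ?thesis
    unfolding good_partition_def by blast
qed

lemma ramsey_iff_no_good_partition:
  fixes G :: "nat graph"
  assumes "simple_graph G" "0 < k"
  shows "ramsey (complete_graph 3) (trees k) G \<longleftrightarrow> (\<nexists>f :: nat \<Rightarrow> nat. good_partition k G f)"
  using good_partition_imp_not_ramsey not_ramsey_imp_good_partition good_partition_nat assms
  by metis

text \<open>Labels are pulled back along the embedding \<open>g\<close> of \<open>F\<close> into
  \<open>G\<close>, which is injective on each class and maps triangles to triangles.\<close>

lemma good_partition_contains:
  assumes G: "simple_graph G" and f: "good_partition k G f" and F: "simple_graph F"
    and "contains G F"
  shows "\<exists>g. good_partition k F (f \<circ> g)"
proof -
  obtain S where S: "subgraph S G" "isomorphic S F"
    using assms(4) unfolding contains_def by blast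
  obtain g where g: "bij_betw g (verts F) (verts S)"
    "\<And>u v. u \<in> verts F \<Longrightarrow> v \<in> verts F \<Longrightarrow> {g u, g v} \<in> edges S \<longleftrightarrow> {u, v} \<in> edges F"
    using isomorphic_inverse[OF S(2)] by metis
  have edge: "{g u, g v} \<in> edges G" if "{u, v} \<in> edges F" for u v
    using that g(2) simple_graph_edgeD[OF F that] S(1) by (auto simp: subgraph_def)
  have "card {u \<in> verts F. f (g u) = i} < k" for i
  proof -
    have "card {u \<in> verts F. f (g u) = i} \<le> card {u \<in> verts G. f u = i}"
    proof (rule card_inj_on_le[where f = g])
      show "inj_on g {u \<in> verts F. f (g u) = i}"
        using g(1) by (auto simp: bij_betw_def inj_on_def)
      show "g ` {u \<in> verts F. f (g u) = i} \<subseteq> {u \<in> verts G. f u = i}"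
        using g(1) S(1) by (auto simp: bij_betw_def subgraph_def)
    qed (use G in \<open>simp add: simple_graph_def\<close>)
    also have "\<dots> < k"
      using f by (simp add: good_partition_def)
    finally show ?thesis .
  qed
  then have "good_partition k F (f \<circ> g)"
    using f edge unfolding good_partition_def comp_def by blast
  then show ?thesis
    by blast
qed

section \<open>Saturation expressed by partitions\<close>

text \<open>Passing to a proper Ramsey subgraph lowers the number of vertices plus edges, so the
  descent ends in a minimal one.\<close>

lemma ramsey_contains_minimal:
  fixes G :: "nat graph"
  assumes "simple_graph G" "ramsey H \<T> G"
  shows "\<exists>F\<in>R_min H \<T>. contains G F"
  using assms
proof (induction "card (verts G) + card (edges G)" arbitrary: G rule: less_induct)
  case less
  show ?case
  proof (cases "ramsey_minimal H \<T> G")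
    case True
    then show ?thesis
      using less.prems subgraph_refl isomorphic_refl unfolding R_min_def contains_def by blast
  next
    case False
    then obtain G' where G': "subgraph G' G" "G' \<noteq> G" "ramsey H \<T> G'"
      using less.prems unfolding ramsey_minimal_def by blast
    have fin: "finite (verts G)" "finite (edges G)"
      using less.prems(1) finite_edges[OF less.prems(1)] unfolding simple_graph_def by blast+
    have "verts G' \<subset> verts G \<or> edges G' \<subset> edges G"
      using G'(1) graph.expand[OF conjI, of G' G] G'(2) unfolding subgraph_def psubset_eq
      by metis
    then have "card (verts G') < card (verts G) \<or> card (edges G') < card (edges G)"
      using psubset_card_mono[OF fin(1)] psubset_card_mono[OF fin(2)] by metis
    moreover have "card (verts G') \<le> card (verts G)" "card (edges G') \<le> card (edges G)"
      using G'(1) card_mono[OF fin(1)] card_mono[OF fin(2)] unfolding subgraph_def by metis+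
    ultimately have "card (verts G') + card (edges G') < card (verts G) + card (edges G)"
      by linarith
    then obtain F where F: "F \<in> R_min H \<T>" "contains G' F"
      using less.hyps[OF _ _ G'(3)] G'(1) unfolding subgraph_def by metis
    then obtain S where "subgraph S G'" "isomorphic S F"
      unfolding contains_def by metis
    moreover have "subgraph S G"
      using \<open>subgraph S G'\<close> G'(1) unfolding subgraph_def by (metis subset_trans)
    ultimately have "contains G F"
      unfolding contains_def by metis
    then show ?thesis
      using F(1) by metis
  qed
qed

lemma R_min_free_iff:
  fixes G :: "nat graph"
  assumes "simple_graph G" "0 < k"
  shows "(\<forall>F\<in>R_min (complete_graph 3) (trees k). \<not> contains G F) \<longleftrightarrow>
    (\<exists>f :: nat \<Rightarrow> nat. good_partition k G f)" (is "?l \<longleftrightarrow> ?r")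
proof
  assume ?l
  then show ?r
    using ramsey_contains_minimal ramsey_iff_no_good_partition assms by blast
next
  assume ?r
  then obtain f :: "nat \<Rightarrow> nat" where f: "good_partition k G f" ..
  show ?l
  proof (intro ballI notI)
    fix F assume F: "F \<in> R_min (complete_graph 3) (trees k)" "contains G F"
    then have "simple_graph F" "ramsey (complete_graph 3) (trees k) F"
      by (auto simp: R_min_def ramsey_minimal_def)
    then show False
      using good_partition_contains[OF assms(1) f _ F(2)] good_partition_imp_not_ramsey by metis
  qed
qed

lemma simple_add_edge:
  assumes "simple_graph G" "e \<in> complement_edges G"
  shows "simple_graph (add_edge G e)"
  using assms by (auto simp: simple_graph_def complement_edges_def add_edge_def)

text \<open>This eliminates the family \<open>R_min\<close>: both bounds work with partitions
  only.\<close>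

lemma saturated_iff:
  fixes G :: "nat graph"
  assumes "0 < k"
  shows "saturated (R_min (complete_graph 3) (trees k)) G \<longleftrightarrow>
    simple_graph G \<and> (\<exists>f :: nat \<Rightarrow> nat. good_partition k G f) \<and>
    (\<forall>e\<in>complement_edges G. \<nexists>f :: nat \<Rightarrow> nat. good_partition k (add_edge G e) f)"
  using R_min_free_iff[OF _ assms] simple_add_edge unfolding saturated_def by blast

subsection \<open>The lower bound\<close>

text \<open>Double counting of incidences, stated for a relation so that it serves red and blue
  adjacency alike.\<close>

lemma handshake:
  assumes V: "finite V" and dom: "\<And>u v. r u v \<Longrightarrow> u \<in> V"
    and sym: "\<And>u v. r u v \<Longrightarrow> r v u" and irrefl: "\<And>u. \<not> r u u"
  shows "(\<Sum>v\<in>V. card {w. r v w}) = 2 * card {{u, v} | u v. r u v}"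
proof -
  let ?R = "{{u, v} | u v. r u v}"
  have "?R \<subseteq> Pow V"
    using dom sym by blast
  then have fin: "finite ?R"
    using V finite_subset by blast
  have inc: "card {e \<in> ?R. v \<in> e} = card {w. r v w}" for v
  proof -
    have "{e \<in> ?R. v \<in> e} = (\<lambda>w. {v, w}) ` {w. r v w}"
      using sym by (auto simp: image_iff)
    moreover have "inj_on (\<lambda>w. {v, w}) {w. r v w}"
      by (auto simp: inj_on_def doubleton_eq_iff)
    ultimately show ?thesis
      by (simp add: card_image)
  qed
  have "(\<Sum>v\<in>V. card {e \<in> ?R. v \<in> e}) = (\<Sum>e\<in>?R. 2)"
  proof (rule sum_multicount_gen[OF V fin], rule ballI)
    fix e assume "e \<in> ?R"
    then obtain u v where "e = {u, v}" "r u v"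
      by blast
    then have "{w \<in> V. w \<in> e} = {u, v}" "u \<noteq> v"
      using dom sym irrefl by blast+
    then show "card {w \<in> V. w \<in> e} = 2"
      by simp
  qed
  then show ?thesis
    unfolding inc by simp
qed

section \<open>Red and blue edges of a rigid partition\<close>

text \<open>Collects what saturation says about one fixed good partition: each missing edge, once
  added, must complete a triangle meeting three classes.\<close>

locale rigid_partition =
  fixes k :: nat and G :: "'a graph" and f :: "'a \<Rightarrow> 'b"
  assumes simple: "simple_graph G"
    and good: "good_partition k G f"
    and clique: "\<lbrakk>u \<in> verts G; v \<in> verts G; u \<noteq> v; f u = f v\<rbrakk> \<Longrightarrow> {u, v} \<in> edges G"
    and common_neighbour: "\<lbrakk>u \<in> verts G; v \<in> verts G; f u \<noteq> f v; {u, v} \<notin> edges G\<rbrakk> \<Longrightarrow>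
      \<exists>w. {u, w} \<in> edges G \<and> {v, w} \<in> edges G \<and> f u \<noteq> f w \<and> f v \<noteq> f w"
begin

definition red :: "'a \<Rightarrow> 'a \<Rightarrow> bool" where
  "red u v \<longleftrightarrow> {u, v} \<in> edges G \<and> f u \<noteq> f v"

text \<open>Edges of \<open>G\<close> need not be mentioned here: by \<open>clique\<close>, two
  vertices of one class are always adjacent.\<close>

definition blue :: "'a \<Rightarrow> 'a \<Rightarrow> bool" where
  "blue u v \<longleftrightarrow> u \<in> verts G \<and> v \<in> verts G \<and> u \<noteq> v \<and> f u = f v"

definition cls :: "'a \<Rightarrow> 'a set" where
  "cls v = {u \<in> verts G. f u = f v}"

definition nb :: "'a \<Rightarrow> 'a set" where
  "nb v = {w. red v w}"

definition red_edges :: "'a set set" where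
  "red_edges = {{u, v} | u v. red u v}"

definition blue_edges :: "'a set set" where
  "blue_edges = {{u, v} | u v. blue u v}"

lemma finite_verts [simp]: "finite (verts G)"
  using simple by (simp add: simple_graph_def)

lemma finite_cls [simp]: "finite (cls v)"
  by (simp add: cls_def)

lemma card_cls: "card (cls v) < k"
  using good by (simp add: good_partition_def cls_def)

lemma red_sym: "red u v \<Longrightarrow> red v u"
  unfolding red_def by (metis insert_commute)

lemma red_verts: "red u v \<Longrightarrow> u \<in> verts G" "red u v \<Longrightarrow> v \<in> verts G"
  using simple_graph_edgeD[OF simple] by (auto simp: red_def)

lemma red_irrefl [simp]: "\<not> red u u"
  by (simp add: red_def)

lemma finite_nb [simp]: "finite (nb v)"
  by (rule finite_subset[OF _ finite_verts]) (auto simp: nb_def red_verts)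

lemma red_triangle_free: "red u v \<Longrightarrow> red v w \<Longrightarrow> \<not> red u w"
  using good unfolding good_partition_def red_def by blast

lemma red_common_neighbour:
  assumes "u \<in> verts G" "v \<in> verts G" "f u \<noteq> f v" "\<not> red u v"
  shows "\<exists>w. red u w \<and> red v w"
  using common_neighbour[of u v] assms by (auto simp: red_def)

lemma finite_red_edges: "finite red_edges"
proof (rule finite_subset)
  show "red_edges \<subseteq> edges G"
    by (auto simp: red_edges_def red_def)
qed (rule finite_edges[OF simple])

lemma sum_degrees_red: "(\<Sum>v\<in>verts G. card (nb v)) = 2 * card red_edges"
  unfolding nb_def red_edges_def
  by (rule handshake) (auto intro: red_verts red_sym)

lemma sum_degrees_blue: "(\<Sum>v\<in>verts G. card (cls v) - 1) = 2 * card blue_edges"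
proof -
  have "(\<Sum>v\<in>verts G. card {w. blue v w}) = 2 * card blue_edges"
    unfolding blue_edges_def by (rule handshake) (auto simp: blue_def)
  moreover have "card {w. blue v w} = card (cls v) - 1" if "v \<in> verts G" for v
  proof -
    have "{w. blue v w} = cls v - {v}" "v \<in> cls v"
      using that by (auto simp: blue_def cls_def)
    then show ?thesis
      by simp
  qed
  ultimately show ?thesis
    by simp
qed

lemma card_edges: "card (edges G) = card red_edges + card blue_edges"
proof -
  have eq: "edges G = red_edges \<union> blue_edges"
  proof (intro equalityI subsetI)
    fix e assume "e \<in> edges G"
    then obtain u v where "u \<in> verts G" "v \<in> verts G" "u \<noteq> v" "e = {u, v}" "{u, v} \<in> edges G"
      using simple_graph_edgeE[OF simple] by metis
    then show "e \<in> red_edges \<union> blue_edges"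
      unfolding red_edges_def blue_edges_def red_def blue_def by (cases "f u = f v") auto
  next
    fix e assume "e \<in> red_edges \<union> blue_edges"
    then show "e \<in> edges G"
      using clique unfolding red_edges_def blue_edges_def red_def blue_def by auto
  qed
  have disj: "red_edges \<inter> blue_edges = {}"
    by (auto simp: red_edges_def blue_edges_def red_def blue_def doubleton_eq_iff)
  have "finite blue_edges"
    using eq finite_edges[OF simple] by simp
  then show ?thesis
    using eq disj finite_red_edges by (simp add: card_Un_disjoint)
qed

section \<open>Counting blue edges\<close>

text \<open>A vertex in a class of size \<open>s\<close> has \<open>s - 1\<close> blue neighbours.
  Here \<open>m\<close> is \<open>k / 2\<close> rounded up; two classes with fewer than
  \<open>m\<close> vertices would have at most \<open>2 * m - 2 < k\<close> together, so at most one
  class is that small and all other vertices have blue degree at least \<open>m - 1\<close>.\<close>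

lemma card_blue_edges_ge:
  fixes m :: nat
  assumes sums: "\<And>u v. u \<in> verts G \<Longrightarrow> v \<in> verts G \<Longrightarrow> f u \<noteq> f v \<Longrightarrow> k \<le> card (cls u) + card (cls v)"
    and k: "5 \<le> k" "2 * m \<le> k + 1" "k \<le> 2 * m"
    and n: "k \<le> card (verts G)"
  shows "(m - 1) * (card (verts G) - k) + 8 \<le> 2 * card blue_edges"
proof (cases "\<forall>v\<in>verts G. m \<le> card (cls v)")
  case True
  obtain d where d: "card (verts G) = k + d"
    using n le_Suc_ex by blast
  have "(\<Sum>v\<in>verts G. m - 1) \<le> 2 * card blue_edges"
    unfolding sum_degrees_blue[symmetric] using True by (intro sum_mono) (simp add: diff_le_mono)
  then have "card (verts G) * (m - 1) \<le> 2 * card blue_edges"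
    by simp
  moreover have "2 * k \<le> (m - 1) * k"
    using k by (intro mult_right_mono) auto
  moreover have "card (verts G) * (m - 1) = (m - 1) * (card (verts G) - k) + (m - 1) * k"
    unfolding d by (simp add: add_mult_distrib mult.commute)
  ultimately show ?thesis
    using k(1) by linarith
next
  case False
  then obtain v where v: "v \<in> verts G" "card (cls v) < m"
    by (meson not_le)
  define s where "s = card (cls v)"
  have s0: "0 < s"
    using v(1) unfolding s_def by (auto simp: card_gt_0_iff cls_def)
  have sub: "cls v \<subseteq> verts G"
    by (auto simp: cls_def)
  have same: "cls u = cls v" if "u \<in> cls v" for u
    using that by (auto simp: cls_def)
  have "(\<Sum>u\<in>cls v. card (cls u) - 1) = s * (s - 1)"
    using same by (simp add: s_def)
  moreover have "(\<Sum>u\<in>verts G - cls v. m - 1) \<le> (\<Sum>u\<in>verts G - cls v. card (cls u) - 1)"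
  proof (intro sum_mono diff_le_mono)
    fix u assume "u \<in> verts G - cls v"
    then show "m \<le> card (cls u)"
      using sums[of u v] v k by (auto simp: cls_def)
  qed
  moreover have "(\<Sum>u\<in>verts G. card (cls u) - 1) =
      (\<Sum>u\<in>verts G - cls v. card (cls u) - 1) + (\<Sum>u\<in>cls v. card (cls u) - 1)"
    using sub by (intro sum.subset_diff) auto
  moreover have "card (verts G - cls v) = card (verts G) - s"
    using sub by (simp add: card_Diff_subset s_def)
  ultimately have ge: "(card (verts G) - s) * (m - 1) + s * (s - 1) \<le> 2 * card blue_edges"
    unfolding sum_degrees_blue[symmetric] by simp
  have sm: "s + 1 \<le> m"
    using v(2) by (simp add: s_def)
  have "card (verts G) - s = (card (verts G) - k) + (k - s)"
    using n sm k by simp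
  then have eq: "(card (verts G) - s) * (m - 1) = (m - 1) * (card (verts G) - k) + (k - s) * (m - 1)"
    by (simp add: algebra_simps)
  \<comment> \<open>Equality holds for \<open>k = 5\<close>, \<open>m = 3\<close> and
    \<open>s = 1\<close> or \<open>s = 2\<close>, which explains the constant 8.\<close>
  have "8 \<le> (k - s) * (m - 1) + s * (s - 1)"
  proof (cases "m = 3")
    case True
    then have "s = 1 \<or> s = 2"
      using sm s0 by auto
    then show ?thesis
      using True k by auto
  next
    case False
    then have "4 * 3 \<le> (k - s) * (m - 1)"
      using k sm by (intro mult_mono) auto
    then show ?thesis
      by simp
  qed
  then show ?thesis
    using ge eq by linarith
qed

section \<open>Counting red edges\<close>

text \<open>A common red neighbour of \<open>v\<close> and \<open>u\<close> lies in
  \<open>nb v\<close>. Thus a small red neighbourhood dominates everything outside the class of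
  \<open>v\<close>, and the red edge counts rest on this.\<close>

lemma red_covered:
  assumes "v \<in> verts G" "u \<in> verts G" "f u \<noteq> f v" "u \<notin> nb v"
  shows "\<exists>a\<in>nb v. red a u"
  using red_common_neighbour[of v u] assms unfolding nb_def by (metis mem_Collect_eq red_sym)

text \<open>Sum the red degrees. The set \<open>U\<close> of vertices outside the class of
  \<open>v\<close> and not adjacent to \<open>v\<close> contributes \<open>3 * card U\<close>. The
  three neighbours of \<open>v\<close> dominate \<open>U\<close> and are joined to \<open>v\<close>,
  giving \<open>card U + 3\<close>, and \<open>v\<close> itself gives 3. Finally \<open>U\<close>
  misses at most \<open>(k - 1) + 3\<close> vertices.\<close>

lemma card_red_edges_ge_degree3:
  assumes n: "k + 2 \<le> card (verts G)" and v: "v \<in> verts G" "card (nb v) = 3"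
    and deg: "\<And>u. u \<in> verts G \<Longrightarrow> 3 \<le> card (nb u)"
  shows "2 * card (verts G) \<le> card red_edges + 2 * k + 1"
proof -
  define U where "U = verts G - cls v - nb v"
  have sub: "nb v \<subseteq> verts G - cls v" "cls v \<subseteq> verts G" "v \<in> cls v"
    using v red_verts by (auto simp: nb_def cls_def red_def)
  have finU: "finite U"
    by (simp add: U_def)
  have "card U = card (verts G) - card (cls v) - 3"
    using sub v(2) by (simp add: U_def card_Diff_subset)
  then have cardU: "card (verts G) \<le> card U + k + 2"
    using card_cls[of v] by linarith
  have "2 * card red_edges = (\<Sum>u\<in>verts G - cls v. card (nb u)) + (\<Sum>u\<in>cls v. card (nb u))"
    using sub by (subst sum_degrees_red[symmetric], intro sum.subset_diff) auto
  moreover have "(\<Sum>u\<in>verts G - cls v. card (nb u)) = (\<Sum>u\<in>U. card (nb u)) + (\<Sum>u\<in>nb v. card (nb u))"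
    unfolding U_def using sub by (intro sum.subset_diff) auto
  \<comment> \<open>From the class of \<open>v\<close> only the degree of \<open>v\<close> itself is
    taken.\<close>
  moreover have "3 \<le> (\<Sum>u\<in>cls v. card (nb u))"
    using member_le_sum[OF sub(3), of "\<lambda>u. card (nb u)"] v(2) by simp
  moreover have "(\<Sum>u\<in>U. 3) \<le> (\<Sum>u\<in>U. card (nb u))"
    by (intro sum_mono deg) (simp add: U_def)
  moreover have "card U + 3 \<le> (\<Sum>a\<in>nb v. card (nb a))"
  proof -
    have "U \<subseteq> (\<Union>a\<in>nb v. nb a \<inter> U)"
      using red_covered[OF v(1)] unfolding U_def nb_def cls_def by fastforce
    then have "card U \<le> card (\<Union>a\<in>nb v. nb a \<inter> U)"
      using finU by (intro card_mono) auto
    also have "\<dots> \<le> (\<Sum>a\<in>nb v. card (nb a \<inter> U))"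
      by (rule card_UN_le) simp
    finally have "card U + 3 \<le> (\<Sum>a\<in>nb v. card (nb a \<inter> U)) + (\<Sum>a\<in>nb v. 1)"
      using v(2) by simp
    also have "\<dots> = (\<Sum>a\<in>nb v. card (nb a \<inter> U) + 1)"
      by (simp only: sum.distrib)
    also have "\<dots> \<le> (\<Sum>a\<in>nb v. card (nb a))"
    proof (rule sum_mono)
      fix a assume "a \<in> nb v"
      then have "insert v (nb a \<inter> U) \<subseteq> nb a"
        using red_sym by (auto simp: nb_def)
      then have "card (insert v (nb a \<inter> U)) \<le> card (nb a)"
        by (intro card_mono) auto
      moreover have "v \<notin> U"
        using sub by (simp add: U_def)
      ultimately show "card (nb a \<inter> U) + 1 \<le> card (nb a)"
        using finU by simp
    qed
    finally show ?thesis .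
  qed
  ultimately have "4 * card U + 6 \<le> 2 * card red_edges"
    by simp
  then show ?thesis
    using cardU by linarith
qed

text \<open>Let \<open>v\<close> have exactly the two red neighbours \<open>a\<close> and \<open>b\<close>. The vertices outside the class of
  \<open>v\<close> that are joined to only one of \<open>a\<close>, \<open>b\<close> each own a red edge avoiding \<open>a\<close> and \<open>b\<close>, and all
  but two of these edges can be chosen distinct.\<close>

lemma red_edges_avoiding_neighbours:
  assumes v: "v \<in> verts G" "nb v = {a, b}"
    and deg: "\<And>u. u \<in> verts G \<Longrightarrow> 2 \<le> card (nb u)"
    and W_def: "W = {u \<in> verts G - cls v - {a, b}. red a u \<noteq> red b u}"
  shows "card W \<le> card {e \<in> red_edges. a \<notin> e \<and> b \<notin> e} + 2"
proof -
  \<comment> \<open>A vertex of \<open>W\<close> with a red neighbour in the class of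
    \<open>v\<close> can own an edge into that class; its other end is outside \<open>W\<close>, so
    the owner is determined. \<open>P\<close> and \<open>Q\<close> are the remaining vertices, on
    the side of \<open>a\<close> and of \<open>b\<close>.\<close>
  define P where "P = {u \<in> W. red a u \<and> nb u \<inter> cls v = {}}"
  define Q where "Q = {u \<in> W. red b u \<and> nb u \<inter> cls v = {}}"
  have W: "u \<in> verts G" "u \<notin> cls v" "u \<noteq> a" "u \<noteq> b" "red a u \<longleftrightarrow> \<not> red b u" if "u \<in> W" for u
    using that by (auto simp: W_def)
  have "a \<in> nb v" "b \<in> nb v"
    by (simp_all add: v(2))
  then have vab: "red v a" "red v b"
    by (simp_all add: nb_def)
  then have clsab: "a \<notin> cls v" "b \<notin> cls v"
    by (auto simp: cls_def red_def)
  have avoid: "\<exists>x. red u x \<and> x \<noteq> a \<and> x \<noteq> b" if "u \<in> W" for u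
  proof (rule ccontr)
    assume "\<not> ?thesis"
    then have "nb u \<subseteq> {a} \<or> nb u \<subseteq> {b}"
      using W(5)[OF that] red_sym unfolding nb_def by blast
    then have "card (nb u) \<le> 1"
      using card_mono[of "{a}" "nb u"] card_mono[of "{b}" "nb u"] by auto
    then show False
      using deg[OF W(1)[OF that]] by simp
  qed
  have covered: "red a u \<or> red b u" if "u \<in> verts G" "u \<notin> cls v" "u \<noteq> a" "u \<noteq> b" for u
    using red_covered[OF v(1) that(1)] that v(2) by (auto simp: cls_def)
  \<comment> \<open>Otherwise a common red neighbour \<open>y\<close> of \<open>p\<close> and
    \<open>q\<close> lies outside the class of \<open>v\<close> and so is adjacent to
    \<open>a\<close> or \<open>b\<close>, closing a red triangle with \<open>p\<close> or with
    \<open>q\<close>.\<close>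
  have PQ: "red p q" if pq: "p \<in> P" "q \<in> Q" "f p \<noteq> f q" for p q
  proof (rule ccontr)
    assume "\<not> red p q"
    moreover have "p \<in> verts G" "q \<in> verts G"
      using pq W(1) by (auto simp: P_def Q_def)
    ultimately obtain y where y: "red p y" "red q y"
      using red_common_neighbour pq(3) by blast
    have "y \<notin> cls v" "y \<noteq> a" "y \<noteq> b"
      using pq y W(5) red_sym by (auto simp: P_def Q_def nb_def)
    moreover have "\<not> red a y" "\<not> red b y"
      using pq y red_triangle_free by (auto simp: P_def Q_def)
    ultimately show False
      using covered[of y] red_verts(2)[OF y(1)] by blast
  qed
  have PQ_disj: "P \<inter> Q = {}"
    using W(5) by (auto simp: P_def Q_def)
  text \<open>A choice of edges \<open>{u, \<phi> u}\<close> can only repeat one on a pair of \<open>P \<times> Q\<close>.\<close>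
  have main: "card W \<le> card {e \<in> red_edges. a \<notin> e \<and> b \<notin> e} + 2"
    if phi: "\<And>u. u \<in> W \<Longrightarrow> red u (\<phi> u) \<and> \<phi> u \<noteq> a \<and> \<phi> u \<noteq> b"
      and own: "\<And>u. u \<in> W \<Longrightarrow> nb u \<inter> cls v \<noteq> {} \<Longrightarrow> \<phi> u \<in> cls v"
      and coll: "\<And>p q. p \<in> P \<Longrightarrow> q \<in> Q \<Longrightarrow> \<phi> p = q \<Longrightarrow> \<phi> q = p \<Longrightarrow> p = x \<or> p = y"
    for \<phi> x y
  proof -
    have inj: "inj_on (\<lambda>u. {u, \<phi> u}) (W - {x, y})"
    proof (rule inj_onI, rule ccontr)
      fix u u' assume u: "u \<in> W - {x, y}" "u' \<in> W - {x, y}" and e: "{u, \<phi> u} = {u', \<phi> u'}"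
        and ne: "u \<noteq> u'"
      then have eq: "\<phi> u = u'" "\<phi> u' = u"
        by (auto simp: doubleton_eq_iff)
      have W': "u \<in> W" "u' \<in> W"
        using u by auto
      then have no: "nb u \<inter> cls v = {}" "nb u' \<inter> cls v = {}"
        using own[of u] own[of u'] eq W(2)[of u] W(2)[of u'] by metis+
      have red: "red u u'"
        using phi[OF W'(1)] eq by simp
      \<comment> \<open>Adjacent vertices of \<open>W\<close> lie on different sides, since two on
        the same side would form a red triangle with \<open>a\<close> or \<open>b\<close>.\<close>
      show False
      proof (cases "red a u")
        case True
        then have "red b u'"
          using red_triangle_free[OF True red] W(5)[OF W'(2)] by simp
        then have "u \<in> P" "u' \<in> Q"
          using True no W' by (simp_all add: P_def Q_def)
        then show False
          using coll[of u u'] eq u by simp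
      next
        case False
        then have "red b u"
          using W(5)[OF W'(1)] by simp
        then have "red a u'"
          using red_triangle_free[OF _ red] W(5)[OF W'(2)] by simp
        then have "u' \<in> P" "u \<in> Q"
          using \<open>red b u\<close> no W' by (simp_all add: P_def Q_def)
        then show False
          using coll[of u' u] eq u by simp
      qed
    qed
    have "(\<lambda>u. {u, \<phi> u}) ` (W - {x, y}) \<subseteq> {e \<in> red_edges. a \<notin> e \<and> b \<notin> e}"
    proof (rule image_subsetI)
      fix u assume "u \<in> W - {x, y}"
      then show "{u, \<phi> u} \<in> {e \<in> red_edges. a \<notin> e \<and> b \<notin> e}"
        using phi[of u] W(3,4)[of u] unfolding red_edges_def by auto
    qed
    then have "card (W - {x, y}) \<le> card {e \<in> red_edges. a \<notin> e \<and> b \<notin> e}"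
      by (rule card_inj_on_le[OF inj]) (simp add: finite_red_edges)
    moreover have "card W - card {x, y} \<le> card (W - {x, y})"
      by (rule diff_card_le_card_Diff) simp
    moreover have "card {x, y} \<le> 2"
      by (simp add: card_insert_if)
    ultimately show ?thesis
      by linarith
  qed
  \<comment> \<open>An admissible choice that prefers an end in the class of \<open>v\<close>
    whenever there is one.\<close>
  define \<sigma> where "\<sigma> = (\<lambda>u. SOME x. red u x \<and> x \<noteq> a \<and> x \<noteq> b \<and> (nb u \<inter> cls v \<noteq> {} \<longrightarrow> x \<in> cls v))"
  have sigma: "red u (\<sigma> u) \<and> \<sigma> u \<noteq> a \<and> \<sigma> u \<noteq> b \<and> (nb u \<inter> cls v \<noteq> {} \<longrightarrow> \<sigma> u \<in> cls v)"
    if "u \<in> W" for u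
  proof -
    have "\<exists>x. red u x \<and> x \<noteq> a \<and> x \<noteq> b \<and> (nb u \<inter> cls v \<noteq> {} \<longrightarrow> x \<in> cls v)"
      using avoid[OF that] clsab unfolding nb_def by (cases "nb u \<inter> cls v = {}") (auto simp: nb_def)
    then show ?thesis
      unfolding \<sigma>_def by (rule someI_ex)
  qed
  show ?thesis
  proof (cases "\<exists>p\<in>P. \<exists>q\<in>Q. f p \<noteq> f q")
    case False
    \<comment> \<open>All of \<open>P\<close> and \<open>Q\<close> share labels here, so no red edge
      joins them and \<open>\<sigma>\<close> has no collisions; the exceptional vertices can be
      anything, and \<open>a\<close> is taken for both.\<close>
    show ?thesis
    proof (rule main[of \<sigma>])
      fix p q assume "p \<in> P" "q \<in> Q" "\<sigma> p = q"
      then have "red p q"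
        using sigma by (auto simp: P_def)
      then show "p = a \<or> p = a"
        using False \<open>p \<in> P\<close> \<open>q \<in> Q\<close> by (auto simp: red_def)
    qed (use sigma in auto)
  next
    case True
    then obtain p0 q0 where pq0: "p0 \<in> P" "q0 \<in> Q" "f p0 \<noteq> f q0"
      by blast
    \<comment> \<open>A representative in \<open>P\<close> of the class of \<open>q0\<close>,
      meaningful only if \<open>P\<close> meets that class.\<close>
    define r where "r = (SOME p. p \<in> P \<and> f p = f q0)"
    have r: "r \<in> P \<and> f r = f q0" if "p \<in> P" "f p = f q0" for p
      unfolding r_def by (rule someI[of _ p]) (use that in simp)
    \<comment> \<open>If \<open>P\<close> meets the class of \<open>q0\<close>, all of
      \<open>Q\<close> is sent to \<open>p0\<close> or \<open>r\<close>, so a repeated edge has its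
      \<open>P\<close>-end among these two. If not, all of \<open>P\<close> is sent to
      \<open>q0\<close>, and \<open>q0\<close> to \<open>p0\<close>, so only the edge
      \<open>{p0, q0}\<close> can repeat.\<close>
    define \<phi> where "\<phi> = (\<lambda>u.
      if u \<in> P \<and> f u \<noteq> f q0 then q0
      else if u \<in> Q \<and> f u \<noteq> f p0 then p0
      else if u \<in> Q \<and> (\<exists>p\<in>P. f p = f q0) then r
      else \<sigma> u)"
    have ab: "p \<noteq> a \<and> p \<noteq> b \<and> nb p \<inter> cls v = {}" if "p \<in> P \<union> Q" for p
      using that W(3,4) by (auto simp: P_def Q_def)
    show ?thesis
    proof (rule main[of \<phi>])
      fix u assume u: "u \<in> W"
      have "red u q0" if "u \<in> P" "f u \<noteq> f q0"
        using PQ that pq0 by blast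
      moreover have "red u p0" if "u \<in> Q" "f u \<noteq> f p0"
        using PQ[of p0 u] that pq0 red_sym by metis
      moreover have "red u r \<and> r \<in> P" if "u \<in> Q" "f u = f p0" "p \<in> P" "f p = f q0" for p
        using PQ[of r u] that pq0 r[OF that(3,4)] red_sym by metis
      ultimately show "red u (\<phi> u) \<and> \<phi> u \<noteq> a \<and> \<phi> u \<noteq> b"
        using sigma[OF u] ab[of p0] ab[of q0] ab[of r] pq0 unfolding \<phi>_def
        by (auto split: if_splits)
      show "\<phi> u \<in> cls v" if "nb u \<inter> cls v \<noteq> {}"
        using that sigma[OF u] ab by (auto simp: \<phi>_def)
    next
      fix p q assume "p \<in> P" "q \<in> Q" "\<phi> p = q" "\<phi> q = p"
      moreover have "p \<notin> Q" "q \<notin> P"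
        using \<open>p \<in> P\<close> \<open>q \<in> Q\<close> PQ_disj by auto
      ultimately show "p = p0 \<or> p = r"
        using pq0 unfolding \<phi>_def by (auto split: if_splits)
    qed
  qed
qed

text \<open>Every vertex of \<open>U\<close> accounts for two red edges: two at \<open>a\<close> and
  \<open>b\<close> if it is joined to both, otherwise one there and one avoiding both. The two
  avoiding edges that may be lost are made up for by the edges from \<open>v\<close> to
  \<open>a\<close> and \<open>b\<close>, so there are at least \<open>2 * card U\<close> red
  edges.\<close>

lemma card_red_edges_ge_degree2:
  assumes n: "k + 1 \<le> card (verts G)" and v: "v \<in> verts G" "card (nb v) = 2"
    and deg: "\<And>u. u \<in> verts G \<Longrightarrow> 2 \<le> card (nb u)"
  shows "2 * card (verts G) \<le> card red_edges + 2 * k + 2"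
proof -
  obtain a b where ab: "nb v = {a, b}" "a \<noteq> b"
    using v(2) card_2_iff by metis
  have "a \<in> nb v" "b \<in> nb v"
    by (simp_all add: ab)
  then have vab: "red v a" "red v b" "red a v" "red b v"
    using red_sym by (simp_all add: nb_def)
  have nab: "\<not> red a b"
    using red_triangle_free[OF vab(3) vab(2)] .
  define U where "U = verts G - cls v - {a, b}"
  define W where "W = {u \<in> U. red a u \<noteq> red b u}"
  define A where "A = {u \<in> U. red a u}"
  define B where "B = {u \<in> U. red b u}"
  have fin: "finite U" "finite A" "finite B"
    by (auto simp: U_def A_def B_def)
  have sub: "{a, b} \<subseteq> verts G - cls v" "cls v \<subseteq> verts G" "v \<in> cls v"
    using v vab red_verts by (auto simp: cls_def red_def)
  have "card U = card (verts G) - card (cls v) - 2"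
    using sub ab(2) by (simp add: U_def card_Diff_subset)
  then have cardU: "card (verts G) \<le> card U + k + 1"
    using card_cls[of v] by linarith
  have cov: "A \<union> B = U"
    using red_covered[OF v(1)] ab(1) by (auto simp: A_def B_def U_def cls_def)
  have "W \<union> A \<inter> B = U" "W \<inter> (A \<inter> B) = {}" "finite W"
    using cov fin by (auto simp: W_def A_def B_def)
  then have "card W + card (A \<inter> B) = card U"
    using fin card_Un_disjoint[of W "A \<inter> B"] by simp
  then have W: "card A + card B + card W = 2 * card U"
    using card_Un_Int[OF fin(2,3)] cov by simp
  have "insert v A \<subseteq> nb a" "insert v B \<subseteq> nb b" "v \<notin> A" "v \<notin> B"
    using vab sub(3) by (auto simp: nb_def A_def B_def U_def)
  then have AB: "card A + 1 \<le> card (nb a)" "card B + 1 \<le> card (nb b)"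
    using fin card_mono[OF finite_nb, of "insert v A" a] card_mono[OF finite_nb, of "insert v B" b]
    by simp_all
  define N where "N = {e \<in> red_edges. a \<notin> e \<and> b \<notin> e}"
  define Ea where "Ea = (\<lambda>w. {a, w}) ` nb a"
  define Eb where "Eb = (\<lambda>w. {b, w}) ` nb b"
  have c: "card Ea = card (nb a)" "card Eb = card (nb b)"
    unfolding Ea_def Eb_def by (rule card_image, auto simp: inj_on_def doubleton_eq_iff)+
  have f: "finite N" "finite Ea" "finite Eb"
    using finite_red_edges by (simp_all add: N_def Ea_def Eb_def)
  have "Ea \<inter> Eb = {}"
    using ab(2) nab by (auto simp: Ea_def Eb_def nb_def doubleton_eq_iff)
  moreover have "N \<inter> (Ea \<union> Eb) = {}"
    by (auto simp: N_def Ea_def Eb_def)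
  ultimately have "card (N \<union> (Ea \<union> Eb)) = card N + card Ea + card Eb"
    using f by (simp add: card_Un_disjoint)
  moreover have "card (N \<union> (Ea \<union> Eb)) \<le> card red_edges"
    by (rule card_mono[OF finite_red_edges]) (auto simp: N_def Ea_def Eb_def nb_def red_edges_def)
  moreover have "card W \<le> card N + 2"
    unfolding N_def by (rule red_edges_avoiding_neighbours[OF v(1) ab(1) deg]) (auto simp: W_def U_def)
  ultimately show ?thesis
    using AB W cardU c by linarith
qed

text \<open>The minimum red degree is 2, 3 or at least 4; in the last case the degree sum alone
  gives \<open>2 * card (verts G)\<close> edges.\<close>

lemma card_red_edges_ge:
  assumes n: "k + 2 \<le> card (verts G)"
    and deg: "\<And>u. u \<in> verts G \<Longrightarrow> 2 \<le> card (nb u)"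
  shows "2 * card (verts G) \<le> card red_edges + 2 * k + 2"
proof -
  consider v where "v \<in> verts G" "card (nb v) = 2"
    | v where "v \<in> verts G" "card (nb v) = 3" "\<And>u. u \<in> verts G \<Longrightarrow> 3 \<le> card (nb u)"
    | "\<And>u. u \<in> verts G \<Longrightarrow> 4 \<le> card (nb u)"
  proof -
    assume *: "\<And>v. v \<in> verts G \<Longrightarrow> card (nb v) = 2 \<Longrightarrow> thesis"
      "\<And>v. v \<in> verts G \<Longrightarrow> card (nb v) = 3 \<Longrightarrow> (\<And>u. u \<in> verts G \<Longrightarrow> 3 \<le> card (nb u)) \<Longrightarrow> thesis"
      "(\<And>u. u \<in> verts G \<Longrightarrow> 4 \<le> card (nb u)) \<Longrightarrow> thesis"
    show thesis
    proof (rule ccontr)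
      assume no: "\<not> thesis"
      have 3: "3 \<le> card (nb u)" if "u \<in> verts G" for u
        using deg[OF that] *(1)[OF that] no by (cases "card (nb u) = 2") auto
      have "4 \<le> card (nb u)" if "u \<in> verts G" for u
        using 3[OF that] *(2)[OF that _ 3] no by (cases "card (nb u) = 3") auto
      then show False
        using *(3) no by blast
    qed
  qed
  then show ?thesis
  proof cases
    case 1
    then show ?thesis
      using card_red_edges_ge_degree2[OF _ 1 deg] n by simp
  next
    case 2
    then show ?thesis
      using card_red_edges_ge_degree3[OF n 2(1,2)] by simp
  next
    case 3
    have "(\<Sum>v\<in>verts G. 4) \<le> 2 * card red_edges"
      unfolding sum_degrees_red[symmetric] by (intro sum_mono 3)
    then show ?thesis
      by simp
  qed
qed

text \<open>With \<open>n\<close> vertices, twice the blue edges give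
  \<open>(m - 1) * (n - k) + 8\<close> and twice the red edges give
  \<open>4 * (n - k) - 4\<close>.\<close>

lemma card_edges_ge:
  fixes m :: nat
  assumes deg: "\<And>u. u \<in> verts G \<Longrightarrow> 2 \<le> card (nb u)"
    and sums: "\<And>u v. u \<in> verts G \<Longrightarrow> v \<in> verts G \<Longrightarrow> f u \<noteq> f v \<Longrightarrow> k \<le> card (cls u) + card (cls v)"
    and k: "5 \<le> k" "2 * m \<le> k + 1" "k \<le> 2 * m"
    and n: "k + 2 \<le> card (verts G)"
  shows "(m + 3) * (card (verts G) - k) + 4 \<le> 2 * card (edges G)"
proof -
  have "(m - 1) * (card (verts G) - k) + 8 \<le> 2 * card blue_edges"
    by (rule card_blue_edges_ge[OF sums k]) (use n in auto)
  moreover have "2 * card (verts G) \<le> card red_edges + 2 * k + 2"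
    by (rule card_red_edges_ge[OF n deg])
  moreover have "(m + 3) * (card (verts G) - k) =
      (m - 1) * (card (verts G) - k) + 4 * (card (verts G) - k)"
    using k by (simp flip: add_mult_distrib)
  ultimately show ?thesis
    using n card_edges by linarith
qed

end

section \<open>Choosing a partition of a saturated graph\<close>

text \<open>Adding the edge \<open>{u, v}\<close> must spoil \<open>f\<close> too. Class sizes do
  not change, so a triangle meeting three classes arises; it uses the new edge, and its third vertex
  is the common neighbour.\<close>

lemma rigid_partition_of_saturated:
  fixes G :: "nat graph" and f :: "nat \<Rightarrow> nat"
  assumes G: "simple_graph G" and f: "good_partition k G f"
    and sat: "\<And>e. e \<in> complement_edges G \<Longrightarrow> \<nexists>f :: nat \<Rightarrow> nat. good_partition k (add_edge G e) f"
  shows "rigid_partition k G f"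
proof -
  have new: "\<exists>x y z. {x, y} \<in> insert {u, v} (edges G) \<and> {y, z} \<in> insert {u, v} (edges G) \<and>
      {x, z} \<in> insert {u, v} (edges G) \<and> f x \<noteq> f y \<and> f y \<noteq> f z \<and> f x \<noteq> f z"
    if "u \<in> verts G" "v \<in> verts G" "u \<noteq> v" "{u, v} \<notin> edges G" for u v
  proof -
    have "{u, v} \<in> complement_edges G"
      using that unfolding complement_edges_def by blast
    then have "\<not> good_partition k (add_edge G {u, v}) f"
      using sat by blast
    then show ?thesis
      using f unfolding good_partition_def add_edge_def by simp
  qed
  have old: "\<not> ({x, y} \<in> edges G \<and> {y, z} \<in> edges G \<and> {x, z} \<in> edges G \<and>
      f x \<noteq> f y \<and> f y \<noteq> f z \<and> f x \<noteq> f z)" for x y z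
    using f unfolding good_partition_def by blast
  have nbr: "f u \<noteq> f v \<and> (\<exists>w. {u, w} \<in> edges G \<and> {v, w} \<in> edges G \<and> f u \<noteq> f w \<and> f v \<noteq> f w)"
    if uv: "u \<in> verts G" "v \<in> verts G" "u \<noteq> v" "{u, v} \<notin> edges G" for u v
  proof -
    obtain x y z where xyz: "{x, y} \<in> insert {u, v} (edges G)" "{y, z} \<in> insert {u, v} (edges G)"
      "{x, z} \<in> insert {u, v} (edges G)" "f x \<noteq> f y" "f y \<noteq> f z" "f x \<noteq> f z"
      using new[OF uv] by metis
    then consider "{x, y} = {u, v}" | "{y, z} = {u, v}" | "{x, z} = {u, v}"
      using old by blast
    then show ?thesis
    proof cases
      case 1
      then have "{y, z} \<in> edges G" "{x, z} \<in> edges G"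
        using xyz by (auto simp: doubleton_eq_iff)
      then show ?thesis
        using 1 xyz by (intro conjI exI[of _ z]) (auto simp: doubleton_eq_iff)
    next
      case 2
      then have "{x, y} \<in> edges G" "{x, z} \<in> edges G"
        using xyz by (auto simp: doubleton_eq_iff)
      then show ?thesis
        using 2 xyz by (intro conjI exI[of _ x]) (auto simp: doubleton_eq_iff insert_commute)
    next
      case 3
      then have "{x, y} \<in> edges G" "{y, z} \<in> edges G"
        using xyz by (auto simp: doubleton_eq_iff)
      then show ?thesis
        using 3 xyz by (intro conjI exI[of _ y]) (auto simp: doubleton_eq_iff insert_commute)
    qed
  qed
  show ?thesis
  proof
    fix u v assume "u \<in> verts G" "v \<in> verts G" "u \<noteq> v" "f u = f v"
    then show "{u, v} \<in> edges G"
      using nbr by blast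
  next
    fix u v assume "u \<in> verts G" "v \<in> verts G" "f u \<noteq> f v" "{u, v} \<notin> edges G"
    then show "\<exists>w. {u, w} \<in> edges G \<and> {v, w} \<in> edges G \<and> f u \<noteq> f w \<and> f v \<noteq> f w"
      using nbr by metis
  qed (use G f in auto)
qed

text \<open>Coarseness is measured by the number of classes, so it survives any change to a good
  partition that does not increase this number.\<close>

definition coarsest_partition :: "nat \<Rightarrow> 'a graph \<Rightarrow> ('a \<Rightarrow> 'b) \<Rightarrow> bool" where
  "coarsest_partition k G f \<longleftrightarrow> good_partition k G f \<and>
     (\<forall>g :: 'a \<Rightarrow> 'b. good_partition k G g \<longrightarrow> card (f ` verts G) \<le> card (g ` verts G))"

lemma coarsest_partition_exists:
  assumes "good_partition k G (f :: 'a \<Rightarrow> 'b)"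
  shows "\<exists>f :: 'a \<Rightarrow> 'b. coarsest_partition k G f"
  using ex_has_least_nat[of "good_partition k G" f "\<lambda>f. card (f ` verts G)"] assms
  unfolding coarsest_partition_def by blast

text \<open>Two classes with fewer than \<open>k\<close> vertices together could be merged. Merging
  keeps every triangle satisfied and lowers the number of classes.\<close>

lemma coarsest_partition_class_sums:
  assumes G: "simple_graph G" and f: "coarsest_partition k G f"
    and uv: "u \<in> verts G" "v \<in> verts G" "f u \<noteq> f v"
  shows "k \<le> card {w \<in> verts G. f w = f u} + card {w \<in> verts G. f w = f v}"
proof (rule ccontr)
  assume small: "\<not> ?thesis"
  have good: "good_partition k G f"
    using f by (simp add: coarsest_partition_def)
  define g where "g = (\<lambda>w. if f w = f u then f v else f w)"
  have "card {w \<in> verts G. g w = i} < k" for i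
  proof (cases "i = f v")
    case True
    have "{w \<in> verts G. g w = i} = {w \<in> verts G. f w = f u} \<union> {w \<in> verts G. f w = f v}"
      using True by (auto simp: g_def)
    then show ?thesis
      using card_Un_le[of "{w \<in> verts G. f w = f u}" "{w \<in> verts G. f w = f v}"] small by simp
  next
    case False
    then have "{w \<in> verts G. g w = i} \<subseteq> {w \<in> verts G. f w = i}"
      by (auto simp: g_def)
    then have "card {w \<in> verts G. g w = i} \<le> card {w \<in> verts G. f w = i}"
      using G by (intro card_mono) (auto simp: simple_graph_def)
    also have "\<dots> < k"
      using good by (simp add: good_partition_def)
    finally show ?thesis .
  qed
  moreover have "g x = g y" if "f x = f y" for x y
    using that by (simp add: g_def)
  ultimately have "good_partition k G g"
    using good unfolding good_partition_def by metis
  then have "card (f ` verts G) \<le> card (g ` verts G)"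
    using f by (simp add: coarsest_partition_def)
  moreover have "g ` verts G \<subseteq> f ` verts G - {f u}"
    using uv by (auto simp: g_def)
  then have "card (g ` verts G) \<le> card (f ` verts G - {f u})"
    using G by (intro card_mono) (auto simp: simple_graph_def)
  moreover have "card (f ` verts G - {f u}) < card (f ` verts G)"
    using G uv by (intro card_Diff1_less) (auto simp: simple_graph_def)
  ultimately show False
    by simp
qed

context rigid_partition
begin

text \<open>Some vertex lies outside the class of \<open>v\<close>, so \<open>v\<close> has a red
  neighbour, hence exactly one, \<open>x\<close>. Another vertex in the class of \<open>x\<close>
  would have to be red-adjacent to \<open>x\<close>, which is impossible within a class.\<close>

lemma low_degree:
  assumes v: "v \<in> verts G" "card (nb v) < 2" and n: "k \<le> card (verts G)"
  shows "\<exists>x. nb v = {x} \<and> cls x = {x}"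
proof -
  have "\<not> verts G \<subseteq> cls v"
    using card_mono[of "cls v" "verts G"] card_cls[of v] n by auto
  then obtain u where u: "u \<in> verts G" "f u \<noteq> f v"
    by (auto simp: cls_def)
  have "nb v \<noteq> {}"
    using red_common_neighbour[of v u] v u by (auto simp: nb_def)
  then have "card (nb v) = 1"
    using v(2) by (auto simp: less_Suc_eq numeral_2_eq_2 card_eq_0_iff)
  then obtain x where x: "nb v = {x}"
    by (auto simp: card_1_singleton_iff)
  then have vx: "red v x"
    unfolding nb_def by blast
  have "y = x" if "y \<in> cls x" for y
  proof (rule ccontr)
    assume ne: "y \<noteq> x"
    have y: "y \<in> verts G" "f y = f x"
      using that by (auto simp: cls_def)
    have "f y \<noteq> f v"
      using vx y by (auto simp: red_def)
    then have "\<exists>a\<in>nb v. red a y"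
      using red_covered[OF v(1) y(1)] x ne by auto
    then show False
      using x y by (simp add: red_def)
  qed
  then have "cls x = {x}"
    using red_verts(2)[OF vx] by (auto simp: cls_def)
  then show ?thesis
    using x by blast
qed

text \<open>After \<open>v\<close> joins \<open>x\<close>, that class has two vertices, and all
  other neighbours of \<open>v\<close> lie in its former class. Two of these share a label, and
  \<open>x\<close> now shares one with \<open>v\<close>, so triangles through \<open>v\<close> are
  harmless.\<close>

lemma good_partition_move:
  assumes k: "3 \<le> k" and v: "nb v = {x}" and x: "cls x = {x}"
  shows "good_partition k G (f(v := f x))" (is "good_partition k G ?g")
proof -
  have vx: "red v x"
    using v unfolding nb_def by blast
  have nbrs: "y = x \<or> f y = f v" if "{v, y} \<in> edges G" for y
    using that v unfolding nb_def red_def by fastforce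
  have "card {u \<in> verts G. ?g u = i} < k" for i
  proof (cases "i = f x")
    case True
    have "{u \<in> verts G. ?g u = i} \<subseteq> {x, v}"
      using x True by (auto simp: cls_def)
    then have "card {u \<in> verts G. ?g u = i} \<le> card {x, v}"
      by (intro card_mono) auto
    moreover have "card {x, v} \<le> 2"
      by (simp add: card_insert_if)
    ultimately show ?thesis
      using k by linarith
  next
    case False
    then have "card {u \<in> verts G. ?g u = i} \<le> card {u \<in> verts G. f u = i}"
      by (intro card_mono) (auto split: if_splits)
    also have "\<dots> < k"
      using good by (simp add: good_partition_def)
    finally show ?thesis .
  qed
  moreover have "?g a = ?g b \<or> ?g b = ?g c \<or> ?g a = ?g c"
    if t: "{a, b} \<in> edges G" "{b, c} \<in> edges G" "{a, c} \<in> edges G" for a b c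
  proof -
    have key: "?g v = ?g y \<or> ?g v = ?g z \<or> ?g y = ?g z" if "{v, y} \<in> edges G" "{v, z} \<in> edges G" for y z
      using nbrs[OF that(1)] nbrs[OF that(2)] by auto
    consider "a = v" | "b = v" | "c = v" | "a \<noteq> v" "b \<noteq> v" "c \<noteq> v"
      by blast
    then show ?thesis
    proof cases
      case 1
      then show ?thesis
        using key[of b c] t by auto
    next
      case 2
      then have "{v, a} \<in> edges G" "{v, c} \<in> edges G"
        using t by (simp_all add: insert_commute)
      then show ?thesis
        using key[of a c] 2 by auto
    next
      case 3
      then have "{v, a} \<in> edges G" "{v, b} \<in> edges G"
        using t by (simp_all add: insert_commute)
      then show ?thesis
        using key[of a b] 3 by auto
    next
      case 4
      then show ?thesis
        using good t unfolding good_partition_def by simp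
    qed
  qed
  ultimately show ?thesis
    unfolding good_partition_def by blast
qed

end

text \<open>Start from a coarsest partition. If some \<open>v\<close> has red degree below 2, moving
  it to the singleton class of its neighbour \<open>x\<close> gives another coarsest partition, and
  in that one all red degrees are at least 2.\<close>

lemma saturated_card_edges_ge:
  fixes G :: "nat graph" and m :: nat
  assumes sat: "saturated (R_min (complete_graph 3) (trees k)) G"
    and k: "5 \<le> k" "2 * m \<le> k + 1" "k \<le> 2 * m"
    and n: "k + 2 \<le> card (verts G)"
  shows "(m + 3) * (card (verts G) - k) + 4 \<le> 2 * card (edges G)"
proof -
  have "0 < k"
    using k by simp
  then have G: "simple_graph G" and "\<exists>f :: nat \<Rightarrow> nat. good_partition k G f"
    and no: "\<And>e. e \<in> complement_edges G \<Longrightarrow> \<nexists>f :: nat \<Rightarrow> nat. good_partition k (add_edge G e) f"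
    using sat saturated_iff by blast+
  then obtain f :: "nat \<Rightarrow> nat" where f: "coarsest_partition k G f"
    using coarsest_partition_exists by blast
  have rigid: "rigid_partition k G g" if "coarsest_partition k G g" for g :: "nat \<Rightarrow> nat"
    using rigid_partition_of_saturated[OF G _ no] that by (simp add: coarsest_partition_def)
  have sums: "k \<le> card (rigid_partition.cls G g u) + card (rigid_partition.cls G g v)"
    if "coarsest_partition k G g" "u \<in> verts G" "v \<in> verts G" "g u \<noteq> g v" for g :: "nat \<Rightarrow> nat" and u v
    using coarsest_partition_class_sums[OF G that] rigid_partition.cls_def[OF rigid[OF that(1)]]
    by simp
  have "\<exists>g :: nat \<Rightarrow> nat. coarsest_partition k G g \<and>
      (\<forall>u\<in>verts G. 2 \<le> card (rigid_partition.nb G g u))"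
  proof (cases "\<forall>u\<in>verts G. 2 \<le> card (rigid_partition.nb G f u)")
    case True
    then show ?thesis
      using f by blast
  next
    case False
    interpret rigid_partition k G f
      by (rule rigid[OF f])
    obtain v where v: "v \<in> verts G" "card (nb v) < 2"
      using False by (meson not_le)
    then obtain x where x: "nb v = {x}" "cls x = {x}"
      using low_degree n by (metis add_leD1)
    have vx: "red v x"
      using x unfolding nb_def by blast
    have xV: "x \<in> verts G" and ne: "x \<noteq> v"
      using red_verts(2)[OF vx] vx by auto
    define g where "g = f(v := f x)"
    have "g ` verts G \<subseteq> f ` verts G"
      using xV by (auto simp: g_def)
    then have "card (g ` verts G) \<le> card (f ` verts G)"
      by (intro card_mono) auto
    moreover have "good_partition k G g"
      unfolding g_def by (rule good_partition_move[OF _ x]) (use k in simp)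
    ultimately have g: "coarsest_partition k G g"
      using f unfolding coarsest_partition_def by (meson order_trans)
    interpret g: rigid_partition k G g
      by (rule rigid[OF g])
    have clsx: "g.cls x = {x, v}"
    proof -
      have "w = x" if "w \<in> verts G" "f w = f x" for w
        using that x(2) unfolding cls_def by blast
      then show ?thesis
        using xV v(1) unfolding g.cls_def by (auto simp: g_def)
    qed
    have "2 \<le> card (g.nb u)" if u: "u \<in> verts G" for u
    proof (rule ccontr)
      assume "\<not> ?thesis"
      then obtain y where y: "g.nb u = {y}" "g.cls y = {y}"
        using g.low_degree[OF u] n by auto
      then have "y \<in> verts G"
        using g.red_verts(2) unfolding g.nb_def by blast
      moreover have "g y \<noteq> g x"
      proof
        assume "g y = g x"
        then have "g.cls y = g.cls x"
          unfolding g.cls_def by simp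
        then show False
          using y(2) clsx ne by auto
      qed
      \<comment> \<open>A remaining vertex of low degree would produce a second small class
        \<open>{y}\<close>, which together with \<open>{x, v}\<close> has only \<open>3 < k\<close>
        vertices.\<close>
      ultimately have "k \<le> card (g.cls x) + card (g.cls y)"
        using sums[OF g xV] by metis
      then show False
        using clsx y(2) ne k by simp
    qed
    then show ?thesis
      using g by blast
  qed
  then obtain g :: "nat \<Rightarrow> nat" where g: "coarsest_partition k G g"
    and deg: "\<forall>u\<in>verts G. 2 \<le> card (rigid_partition.nb G g u)"
    by blast
  interpret rigid_partition k G g
    by (rule rigid[OF g])
  show ?thesis
    by (rule card_edges_ge[OF _ sums[OF g] k n]) (use deg in auto)
qed

subsection \<open>The upper bound\<close>

text \<open>Division by \<open>q\<close> is injective on a residue class. This bounds the number of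
  earlier vertices in the clique of the outer vertex with index \<open>j\<close>.\<close>

lemma card_residue_class_below:
  "card {i. i < j \<and> i mod q = j mod q} \<le> (j::nat) div q"
proof -
  have "card {i. i < j \<and> i mod q = j mod q} \<le> card {..<j div q}"
  proof (rule card_inj_on_le[where f = "\<lambda>i. i div q"])
    show "inj_on (\<lambda>i. i div q) {i. i < j \<and> i mod q = j mod q}"
      by (auto simp: inj_on_def) (metis div_mult_mod_eq)
    have "i div q < j div q" if "i < j" "i mod q = j mod q" for i
    proof (rule ccontr)
      assume "\<not> ?thesis"
      then have "i div q = j div q"
        using that(1) div_le_mono[of i j q] by simp
      then show False
        using that by (metis div_mult_mod_eq less_irrefl)
    qed
    then show "(\<lambda>i. i div q) ` {i. i < j \<and> i mod q = j mod q} \<subseteq> {..<j div q}"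
      by auto
  qed simp
  then show ?thesis
    by simp
qed

lemma card_residue_class:
  fixes q m r i :: nat
  assumes "i < q" "r < q"
  shows "m \<le> card {j. j < q * m + r \<and> j mod q = i}" "card {j. j < q * m + r \<and> j mod q = i} \<le> m + 1"
proof -
  have "card {..<m} \<le> card {j. j < q * m + r \<and> j mod q = i}"
  proof (rule card_inj_on_le[where f = "\<lambda>t. q * t + i"])
    show "inj_on (\<lambda>t. q * t + i) {..<m}"
      using assms by (auto simp: inj_on_def)
    have "q * t + i < q * m + r" if "t < m" for t
    proof -
      have "q * Suc t \<le> q * m"
        using that by (intro mult_le_mono2) simp
      then show ?thesis
        using assms by simp
    qed
    then show "(\<lambda>t. q * t + i) ` {..<m} \<subseteq> {j. j < q * m + r \<and> j mod q = i}"
      using assms by auto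
  qed simp
  then show "m \<le> card {j. j < q * m + r \<and> j mod q = i}"
    by simp
  have "card {j. j < q * m + r \<and> j mod q = i} \<le> card {..m}"
  proof (rule card_inj_on_le[where f = "\<lambda>j. j div q"])
    show "inj_on (\<lambda>j. j div q) {j. j < q * m + r \<and> j mod q = i}"
      by (auto simp: inj_on_def) (metis div_mult_mod_eq)
    have "j div q \<le> m" if "j < q * m + r" for j
    proof -
      have "j div q < Suc m"
        using that assms by (intro less_mult_imp_div_less) (simp add: mult.commute)
      then show ?thesis
        by simp
    qed
    then show "(\<lambda>j. j div q) ` {j. j < q * m + r \<and> j mod q = i} \<subseteq> {..m}"
      by auto
  qed simp
  then show "card {j. j < q * m + r \<and> j mod q = i} \<le> m + 1"
    by simp
qed

text \<open>The quotient is constant on blocks of length \<open>q\<close>; the formula is doubled to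
  avoid division.\<close>

lemma sum_div:
  fixes q m r :: nat
  assumes "r \<le> q" "0 < q"
  shows "2 * (\<Sum>j<q * m + r. j div q) = q * (m * (m - 1)) + 2 * (r * m)"
  using assms
proof (induction m arbitrary: r)
  case 0
  then show ?case
    by simp
next
  case (Suc m)
  have "(\<Sum>j<q * Suc m + r. j div q) = (\<Sum>j<q * Suc m. j div q) + (\<Sum>j = q * Suc m..<q * Suc m + r. j div q)"
    by (simp add: sum.atLeastLessThan_concat lessThan_atLeast0)
  moreover have "(\<Sum>j = q * Suc m..<q * Suc m + r. j div q) = (\<Sum>j = q * Suc m..<q * Suc m + r. Suc m)"
  proof (rule sum.cong)
    fix j assume j: "j \<in> {q * Suc m..<q * Suc m + r}"
    then have "j < Suc (Suc m) * q"
      using Suc.prems by (simp add: algebra_simps)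
    then have "j div q < Suc (Suc m)"
      by (rule less_mult_imp_div_less)
    moreover have "Suc m \<le> j div q"
      using j Suc.prems div_le_mono[of "q * Suc m" j q] by simp
    ultimately show "j div q = Suc m"
      by simp
  qed simp
  \<comment> \<open>The induction hypothesis is used with \<open>r = q\<close>, which is why
    \<open>r \<le> q\<close> is assumed rather than \<open>r < q\<close>.\<close>
  moreover have "2 * (\<Sum>j<q * Suc m. j div q) = q * (m * (m - 1)) + 2 * (q * m)"
    using Suc.IH[of q] Suc.prems by (simp add: add.commute)
  moreover have "q * (m * (m - 1)) + 2 * (q * m) = q * (Suc m * m)"
    by (cases m) (simp_all add: algebra_simps)
  ultimately show ?case
    by simp
qed

text \<open>Here \<open>k = h + 1\<close>. The vertices \<open>{..<h}\<close> and \<open>{h..<2 * h}\<close> induce a complete graph minus the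
  edge joining the hubs \<open>0\<close> and \<open>h\<close>. The remaining \<open>q * m + r\<close> vertices form \<open>q\<close> cliques, given by
  residues modulo \<open>q\<close>, and are joined to both hubs; the exception is \<open>2 * h\<close>, which is joined
  to all of \<open>{h..<2 * h}\<close> instead of to \<open>0\<close> and so forces the two hubs into different classes.\<close>

locale hub_graph =
  fixes h m q r :: nat
  assumes h: "4 \<le> h" "2 * m \<le> h + 2" "h + 1 \<le> 2 * m"
    and qr: "r < q" "0 < q"
begin

definition order :: nat where
  "order = 2 * h + (q * m + r)"

definition label :: "nat \<Rightarrow> nat" where
  "label v = (if v < h then 0 else if v < 2 * h then 1 else 2 + (v - 2 * h) mod q)"

text \<open>Edges between classes are listed with the smaller end first, so triangle-freeness need
  only be checked on sorted triples.\<close>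

definition cross :: "nat \<Rightarrow> nat \<Rightarrow> bool" where
  "cross u v \<longleftrightarrow>
     u < h \<and> h \<le> v \<and> v < 2 * h \<and> \<not> (u = 0 \<and> v = h) \<or>
     u = 0 \<and> 2 * h < v \<or>
     u = h \<and> 2 * h \<le> v \<or>
     h \<le> u \<and> u < 2 * h \<and> v = 2 * h"

definition hub_graph :: "nat graph" where
  "hub_graph = Graph {..<order} {{u, v} | u v. u < v \<and> v < order \<and> (label u = label v \<or> cross u v)}"

lemma verts_hub_graph [simp]: "verts hub_graph = {..<order}"
  by (simp add: hub_graph_def)

lemma order_gt: "2 * h + 2 < order"
proof -
  have "3 \<le> m"
    using h by simp
  then have "1 * 3 \<le> q * m"
    using qr by (intro mult_le_mono) auto
  then show ?thesis
    by (simp add: order_def)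
qed

lemma label_left: "v < h \<Longrightarrow> label v = 0"
  by (simp add: label_def)

lemma label_right: "h \<le> v \<Longrightarrow> v < 2 * h \<Longrightarrow> label v = 1"
  by (simp add: label_def)

lemma crossI:
  "u < h \<Longrightarrow> h \<le> v \<Longrightarrow> v < 2 * h \<Longrightarrow> \<not> (u = 0 \<and> v = h) \<Longrightarrow> cross u v"
  "2 * h < v \<Longrightarrow> cross 0 v"
  "2 * h \<le> v \<Longrightarrow> cross h v"
  "h \<le> u \<Longrightarrow> u < 2 * h \<Longrightarrow> cross u (2 * h)"
  unfolding cross_def by simp_all

lemma cross_less: "cross u v \<Longrightarrow> u < v"
  using h by (auto simp: cross_def)

lemma cross_label: "cross u v \<Longrightarrow> label u \<noteq> label v"
  using h by (auto simp: cross_def label_def)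

lemma cross_triangle_free: "cross u v \<Longrightarrow> cross v w \<Longrightarrow> \<not> cross u w"
  using h by (auto simp: cross_def)

lemma cross_triangle_free':
  assumes "cross u v \<or> cross v u" "cross v w \<or> cross w v" "cross u w \<or> cross w u"
  shows False
  using assms cross_triangle_free[of u v w] cross_triangle_free[of u w v] cross_triangle_free[of v u w]
    cross_triangle_free[of v w u] cross_triangle_free[of w u v] cross_triangle_free[of w v u]
    cross_less[of u v] cross_less[of v u] cross_less[of v w] cross_less[of w v]
    cross_less[of u w] cross_less[of w u]
  by auto

lemma edge_hub_graph_iff:
  "{u, v} \<in> edges hub_graph \<longleftrightarrow>
     u < order \<and> v < order \<and> u \<noteq> v \<and> (label u = label v \<or> cross u v \<or> cross v u)"
proof
  assume "{u, v} \<in> edges hub_graph"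
  then show "u < order \<and> v < order \<and> u \<noteq> v \<and> (label u = label v \<or> cross u v \<or> cross v u)"
    by (auto simp: hub_graph_def doubleton_eq_iff)
next
  assume *: "u < order \<and> v < order \<and> u \<noteq> v \<and> (label u = label v \<or> cross u v \<or> cross v u)"
  show "{u, v} \<in> edges hub_graph"
  proof (cases "u < v")
    case True
    then have "label u = label v \<or> cross u v"
      using * cross_less by fastforce
    then show ?thesis
      using * True by (auto simp: hub_graph_def)
  next
    case False
    then have "v < u" "label v = label u \<or> cross v u"
      using * cross_less by fastforce+
    moreover have "{u, v} = {v, u}"
      by blast
    ultimately show ?thesis
      using * by (auto simp: hub_graph_def)
  qed
qed

lemma simple_hub_graph: "simple_graph hub_graph"
proof -
  have "\<exists>u<order. \<exists>v<order. u \<noteq> v \<and> e = {u, v}" if "e \<in> edges hub_graph" for e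
    using that unfolding hub_graph_def by auto (metis less_irrefl less_trans)+
  then show ?thesis
    by (simp add: simple_graph_def) blast
qed

text \<open>Both bounds matter: \<open>m + 1 \<le> h\<close> makes the outer cliques admissible as
  classes, and \<open>2 * m > h\<close> prevents two of them from sharing a class.\<close>

lemma card_label_class_outer:
  assumes "2 * h \<le> v"
  shows "m \<le> card {u \<in> verts hub_graph. label u = label v}"
    "card {u \<in> verts hub_graph. label u = label v} \<le> m + 1"
proof -
  let ?i = "(v - 2 * h) mod q"
  have "{u \<in> verts hub_graph. label u = label v} =
      (+) (2 * h) ` {j. j < q * m + r \<and> j mod q = ?i}" (is "?L = ?R")
  proof (intro equalityI subsetI)
    fix u assume "u \<in> ?L"
    then have "u = 2 * h + (u - 2 * h)" "u - 2 * h < q * m + r" "(u - 2 * h) mod q = ?i"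
      using assms h by (auto simp: label_def order_def split: if_splits)
    then show "u \<in> ?R"
      by blast
  qed (use assms in \<open>auto simp: label_def order_def\<close>)
  then have "card {u \<in> verts hub_graph. label u = label v} = card {j. j < q * m + r \<and> j mod q = ?i}"
    by (simp add: card_image)
  then show "m \<le> card {u \<in> verts hub_graph. label u = label v}"
    "card {u \<in> verts hub_graph. label u = label v} \<le> m + 1"
    using card_residue_class[of ?i q r m] qr by simp_all
qed

lemma good_partition_label: "good_partition (Suc h) hub_graph label"
proof -
  have "card {u \<in> verts hub_graph. label u = i} < Suc h" for i
  proof (cases "\<exists>v\<ge>2 * h. i = label v")
    case True
    then obtain v where v: "2 * h \<le> v" "i = label v"
      by blast
    then show ?thesis
      using card_label_class_outer(2)[OF v(1)] h by simp
  next
    case False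
    have core: "u < 2 * h" if "label u = i" for u
      using False that not_le by metis
    have "{u \<in> verts hub_graph. label u = i} \<subseteq> {..<h} \<or>
        {u \<in> verts hub_graph. label u = i} \<subseteq> {h..<2 * h}"
    proof (cases "i = 0")
      case True
      have "{u \<in> verts hub_graph. label u = i} \<subseteq> {..<h}"
        using True by (auto simp: label_def split: if_splits)
      then show ?thesis ..
    next
      case False
      have "u \<in> {h..<2 * h}" if "label u = i" for u
        using core[OF that] that False by (cases "u < h") (auto simp: label_def)
      then show ?thesis
        by blast
    qed
    then have "card {u \<in> verts hub_graph. label u = i} \<le> h"
      using card_mono[of "{..<h}" "{u \<in> verts hub_graph. label u = i}"]
        card_mono[of "{h..<2 * h}" "{u \<in> verts hub_graph. label u = i}"] by auto
    then show ?thesis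
      using h by linarith
  qed
  moreover have "label u = label v \<or> label v = label w \<or> label u = label w"
    if "{u, v} \<in> edges hub_graph" "{v, w} \<in> edges hub_graph" "{u, w} \<in> edges hub_graph" for u v w
  proof (rule ccontr)
    assume "\<not> ?thesis"
    then have "cross u v \<or> cross v u" "cross v w \<or> cross w v" "cross u w \<or> cross w u"
      using that by (simp_all add: edge_hub_graph_iff)
    then show False
      by (rule cross_triangle_free')
  qed
  ultimately show ?thesis
    unfolding good_partition_def by blast
qed

text \<open>The hub \<open>h\<close> serves two outer vertices, and also an outer vertex with a
  non-hub below \<open>h\<close>. The hub \<open>0\<close> serves a vertex strictly between
  \<open>h\<close> and \<open>2 * h\<close> with an outer vertex other than \<open>2 * h\<close>.
  The pair \<open>0\<close>, \<open>2 * h\<close> has \<open>h + 1\<close>, and the two hubs have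
  \<open>2 * h + 1\<close>.\<close>

lemma nonedge_common_neighbour:
  assumes "u < v" "v < order" "{u, v} \<notin> edges hub_graph"
  shows "label u \<noteq> label v \<and>
    (\<exists>w. {u, w} \<in> edges hub_graph \<and> {v, w} \<in> edges hub_graph \<and> label u \<noteq> label w \<and> label v \<noteq> label w)"
proof -
  have no: "label u \<noteq> label v" "\<not> cross u v"
    using assms by (auto simp: edge_hub_graph_iff)
  have wit: "\<exists>w < order. (cross u w \<or> cross w u) \<and> (cross v w \<or> cross w v)"
    if "w < order" "cross u w \<or> cross w u" "cross v w \<or> cross w v" for w
    using that by blast
  have bounds: "2 * h < 2 * h + 1" "h < Suc h" "h < 2 * h" "h < 2 * h" "0 < h"
    "2 * h + 1 < order" "Suc h < order" "h < order" "0 < order"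
    using h order_gt by linarith+
  have "\<exists>w < order. (cross u w \<or> cross w u) \<and> (cross v w \<or> cross w v)"
  proof (cases "2 * h \<le> u")
    case True
    then have "cross (h) u" "cross h v"
      using assms(1) by (auto intro!: crossI(3))
    then show ?thesis
      using wit bounds by blast
  next
    case u: False
    show ?thesis
    proof (cases "2 * h \<le> v")
      case v: True
      show ?thesis
      proof (cases "u < h")
        case True
        show ?thesis
        proof (cases "u = 0")
          case u0: True
          then have "v = 2 * h"
            using no(2) crossI(2)[of v] v by (cases "2 * h < v") auto
          moreover have "cross (Suc h) (2 * h)"
            by (rule crossI(4)) (use h in simp_all)
          moreover have "cross 0 (Suc h)"
            by (rule crossI(1)) (use h in simp_all)
          ultimately show ?thesis
            using u0 wit bounds by blast
        next
          case False
          then have "cross u (h)"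
            using True bounds by (intro crossI(1)) simp_all
          then show ?thesis
            using crossI(3)[OF v] wit bounds by blast
        qed
      next
        case False
        have "u \<noteq> h"
          using no(2) crossI(3)[OF v] by auto
        then have "cross 0 u"
          using False u bounds(5) by (intro crossI(1)) linarith+
        moreover have "v \<noteq> 2 * h"
          using no(2) crossI(4)[of u] False u by auto
        then have "cross 0 v"
          using v by (intro crossI(2)) linarith
        ultimately show ?thesis
          using wit bounds by blast
      qed
    next
      case v: False
      have "h \<le> v"
        using no(1) label_left[of u] label_left[of v] assms(1) by (cases "v < h") auto
      moreover have "u < h"
        using no(1) label_right[of u] label_right[of v] assms(1) u v \<open>h \<le> v\<close>
        by (cases "u < h") auto
      ultimately have "u = 0" "v = h"
        using no(2) crossI(1)[of u v] v not_le by metis+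
      moreover have "cross 0 (2 * h + 1)" "cross (h) (2 * h + 1)"
        using bounds by (auto intro!: crossI(2,3))
      ultimately show ?thesis
        using wit bounds by blast
    qed
  qed
  then show ?thesis
  proof (elim exE conjE)
    fix w assume w: "w < order" "cross u w \<or> cross w u" "cross v w \<or> cross w v"
    then have "label u \<noteq> label w" "label v \<noteq> label w"
      using cross_label[of u w] cross_label[of w u] cross_label[of v w] cross_label[of w v] by auto
    then show ?thesis
      using w assms(1,2) no by (intro conjI exI[of _ w]) (auto simp: edge_hub_graph_iff)
  qed
qed

section \<open>Uniqueness of the partition and saturation of the construction\<close>

text \<open>\<open>H\<close> stands for the hub graph with possibly more edges, so the conclusion
  applies after an edge has been added.\<close>

lemma good_partition_unique:
  assumes g: "good_partition (Suc h) H g" and H: "verts H = verts hub_graph" "edges hub_graph \<subseteq> edges H"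
    and uv: "u < order" "v < order" "label u \<noteq> label v"
  shows "g u \<noteq> g v"
proof -
  let ?C = "{..<2 * h}"
  define cl where "cl i = {u. u < order \<and> g u = i}" for i
  have fin: "finite (cl i)" for i
    by (simp add: cl_def)
  have size: "card (cl i) < Suc h" for i
    using g H(1) by (simp add: good_partition_def cl_def lessThan_def)
  have tri: "g a = g b \<or> g b = g c \<or> g a = g c"
    if "{a, b} \<in> edges hub_graph" "{b, c} \<in> edges hub_graph" "{a, c} \<in> edges hub_graph" for a b c
    using g H(2) that unfolding good_partition_def by blast
  have core_lt: "a < order" if "a < 2 * h" for a
    using that order_gt by simp
  have core: "{a, b} \<in> edges hub_graph"
    if "a < 2 * h" "b < 2 * h" "a \<noteq> b" "{a, b} \<noteq> {0, h}" for a b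
    using that order_gt by (auto simp: edge_hub_graph_iff label_def cross_def doubleton_eq_iff)
  \<comment> \<open>These \<open>2 * h - 1 > h\<close> vertices are too many for one class. They
    form a clique, as the missing core edge ends in \<open>0\<close>, so they meet exactly two
    classes, those of \<open>1\<close> and \<open>p\<close>.\<close>
  have "\<not> {1..<2 * h} \<subseteq> cl (g 1)"
    using card_mono[OF fin, of "{1..<2 * h}" "g 1"] size[of "g 1"] h by auto
  then obtain p where "p \<in> {1..<2 * h}" "p \<notin> cl (g 1)"
    by blast
  then have p: "1 \<le> p" "p < 2 * h" "g p \<noteq> g 1"
    using core_lt[of p] by (auto simp: cl_def)
  have two: "g a = g 1 \<or> g a = g p" if "1 \<le> a" "a < 2 * h" for a
  proof (rule ccontr)
    assume "\<not> ?thesis"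
    moreover from this have "a \<noteq> 1" "a \<noteq> p" "p \<noteq> 1"
      using p by auto
    ultimately show False
      using tri[of a 1 p] core[of a 1] core[of 1 p] core[of a p] that p h
      by (auto simp: doubleton_eq_iff)
  qed
  \<comment> \<open>If class \<open>i\<close> had no core vertex besides hubs, class
    \<open>j\<close> would contain the \<open>2 * h - 2 > h\<close> others.\<close>
  have other: "\<exists>x. x < 2 * h \<and> x \<noteq> 0 \<and> x \<noteq> h \<and> g x = i" if i: "{1..<2 * h} \<subseteq> cl i \<union> cl j" for i j
  proof (rule ccontr)
    assume no: "\<not> ?thesis"
    have "{1..<2 * h} - {h} \<subseteq> cl j"
    proof
      fix x assume x: "x \<in> {1..<2 * h} - {h}"
      then have "x \<in> cl i \<union> cl j"
        using i by blast
      moreover have "x \<notin> cl i"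
      proof
        assume "x \<in> cl i"
        then have "g x = i"
          by (simp add: cl_def)
        moreover have "x < 2 * h" "x \<noteq> 0" "x \<noteq> h"
          using x by simp_all
        ultimately show False
          using no by blast
      qed
      ultimately show "x \<in> cl j"
        by blast
    qed
    then have "card ({1..<2 * h} - {h}) \<le> card (cl j)"
      by (rule card_mono[OF fin])
    moreover have "card ({1..<2 * h} - {h}) = 2 * h - 2"
      using h by (subst card_Diff_singleton) auto
    ultimately show False
      using size[of j] h by linarith
  qed
  have sub: "{1..<2 * h} \<subseteq> cl (g 1) \<union> cl (g p)"
  proof
    fix a assume "a \<in> {1..<2 * h}"
    then show "a \<in> cl (g 1) \<union> cl (g p)"
      using two[of a] core_lt[of a] by (auto simp: cl_def)
  qed
  obtain x where x: "x < 2 * h" "x \<noteq> 0" "x \<noteq> h" "g x = g 1"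
    using other[OF sub] by blast
  obtain y where y: "y < 2 * h" "y \<noteq> 0" "y \<noteq> h" "g y = g p"
    using other[of "g p" "g 1"] sub by (metis Un_commute)
  have "x \<noteq> y"
    using x y p(3) by auto
  \<comment> \<open>As \<open>x\<close> and \<open>y\<close> are not hubs, \<open>0\<close> is
    adjacent to both, and this triangle forces \<open>0\<close> into one of the two classes.\<close>
  have ne: "{0, x} \<noteq> {0, h}" "{0, y} \<noteq> {0, h}" "{x, y} \<noteq> {0, h}"
    unfolding doubleton_eq_iff using x(2,3) y(2,3) by metis+
  have "0 < 2 * h"
    using h by simp
  then have "{0, x} \<in> edges hub_graph" "{x, y} \<in> edges hub_graph" "{0, y} \<in> edges hub_graph"
    using core[of 0 x] core[of x y] core[of 0 y] x(1,2) y(1,2) ne \<open>x \<noteq> y\<close> by metis+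
  then have "g 0 = g 1 \<or> g 0 = g p"
    using tri[of 0 x y] x(4) y(4) p(3) by simp
  then have in_core: "g a = g 1 \<or> g a = g p" if "a < 2 * h" for a
    using two[of a] that by (cases "a = 0") auto
  have C: "?C \<subseteq> cl (g 1) \<union> cl (g p)"
  proof
    fix a assume "a \<in> ?C"
    then show "a \<in> cl (g 1) \<union> cl (g p)"
      using in_core[of a] core_lt[of a] by (auto simp: cl_def)
  qed
  \<comment> \<open>Two classes of at most \<open>h\<close> vertices cover the \<open>2 * h\<close>
    core vertices, so they are full and contain no outer vertex.\<close>
  have "card (cl (g 1) \<union> cl (g p)) \<le> card (cl (g 1)) + card (cl (g p))"
    by (rule card_Un_le)
  then have "card (cl (g 1) \<union> cl (g p)) \<le> card ?C"
    using size[of "g 1"] size[of "g p"] by simp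
  then have C_eq: "?C = cl (g 1) \<union> cl (g p)"
    using C fin by (intro card_seteq) auto
  have out: "g a \<noteq> g 1 \<and> g a \<noteq> g p" if "a < order" "2 * h \<le> a" for a
  proof -
    have "a \<notin> cl (g 1) \<union> cl (g p)"
      using that unfolding C_eq[symmetric] by simp
    then show ?thesis
      using that(1) by (simp add: cl_def)
  qed
  \<comment> \<open>The exceptional vertex \<open>2 * h\<close> lies outside both core classes, so
    its triangle with \<open>b\<close> and \<open>h\<close> forces the latter two together.\<close>
  have B: "g b = g (h)" if "h \<le> b" "b < 2 * h" for b
  proof (cases "b = h")
    case False
    have "{b, h} \<in> edges hub_graph" "{b, 2 * h} \<in> edges hub_graph" "{h, 2 * h} \<in> edges hub_graph"
      using that False h order_gt by (auto simp: edge_hub_graph_iff label_def cross_def)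
    then show ?thesis
      using tri[of b "h" "2 * h"] out[of "2 * h"] in_core[of b] in_core[of "h"]
        that order_gt h by auto
  qed simp
  \<comment> \<open>The class of \<open>h\<close> is already filled by
    \<open>{h..<2 * h}\<close>.\<close>
  have A: "g a \<noteq> g (h)" if "a < h" for a
  proof
    assume "g a = g (h)"
    moreover have "a < order"
      using core_lt[of a] that by simp
    moreover have "{h..<2 * h} \<subseteq> cl (g (h))"
    proof
      fix b assume "b \<in> {h..<2 * h}"
      then show "b \<in> cl (g (h))"
        using B[of b] core_lt[of b] by (simp add: cl_def)
    qed
    ultimately have "insert a {h..<2 * h} \<subseteq> cl (g (h))"
      by (simp add: cl_def)
    then have "card (insert a {h..<2 * h}) \<le> card (cl (g (h)))"
      by (rule card_mono[OF fin])
    then show False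
      using size[of "g (h)"] that by simp
  qed
  \<comment> \<open>In the triangle with hub \<open>h\<close>, only \<open>a\<close> and
    \<open>b\<close> can share a class.\<close>
  have outer: "g a = g b" if "label a = label b" "2 * h \<le> a" "a < order" "b < order" for a b
  proof (cases "a = b")
    case False
    have b: "2 * h \<le> b"
      using that by (auto simp: label_def split: if_splits)
    have "{a, b} \<in> edges hub_graph" "{b, h} \<in> edges hub_graph" "{a, h} \<in> edges hub_graph"
      using that False b h by (auto simp: edge_hub_graph_iff cross_def)
    then show ?thesis
      using tri[of a b "h"] out[of a] out[of b] in_core[of "h"] that b h by auto
  qed simp
  \<comment> \<open>Two outer cliques have at least \<open>2 * m \<ge> h + 1\<close> vertices
    together, too many for one class.\<close>
  have outer': "g a \<noteq> g b"
    if ab: "label a \<noteq> label b" "2 * h \<le> a" "2 * h \<le> b" "a < order" "b < order" for a b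
  proof
    assume eq: "g a = g b"
    let ?X = "\<lambda>c. {u \<in> verts hub_graph. label u = label c}"
    have "x \<in> cl (g a)" if "x \<in> ?X a \<union> ?X b" for x
      using that outer[of a x] outer[of b x] ab eq by (auto simp: cl_def)
    then have "?X a \<union> ?X b \<subseteq> cl (g a)"
      by blast
    then have "card (?X a \<union> ?X b) \<le> card (cl (g a))"
      by (rule card_mono[OF fin])
    moreover have "card (?X a \<union> ?X b) = card (?X a) + card (?X b)"
      using ab(1) by (intro card_Un_disjoint) auto
    ultimately show False
      using card_label_class_outer(1)[OF ab(2)] card_label_class_outer(1)[OF ab(3)] size[of "g a"] h
      by linarith
  qed
  have sep: "g a \<noteq> g b" if "a < b" "label a \<noteq> label b" "b < order" for a b
  proof -
    have "h \<le> b"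
    proof (rule ccontr)
      assume "\<not> h \<le> b"
      then show False
        using that label_left[of a] label_left[of b] by simp
    qed
    moreover have "a < h" if "b < 2 * h"
    proof (rule ccontr)
      assume "\<not> a < h"
      then show False
        using that \<open>a < b\<close> \<open>label a \<noteq> label b\<close> label_right[of a] label_right[of b] by simp
    qed
    ultimately consider "a < h" "h \<le> b" "b < 2 * h" | "a < 2 * h" "2 * h \<le> b" | "2 * h \<le> a"
      using not_le by blast
    then show ?thesis
    proof cases
      case 1
      then show ?thesis
        using A[of a] B[of b] by simp
    next
      case 2
      then show ?thesis
        using in_core[of a] out[of b] that by auto
    next
      case 3
      then show ?thesis
        using outer'[of a b] that by simp
    qed
  qed
  show ?thesis
    using sep[of u v] sep[of v u] uv by (metis linorder_neqE_nat)
qed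

text \<open>An added edge completes a triangle with three different labels, and every good partition
  of the new graph would separate all three vertices.\<close>

lemma saturated_hub_graph: "saturated (R_min (complete_graph 3) (trees (Suc h))) hub_graph"
proof -
  have "\<not> good_partition (Suc h) (add_edge hub_graph e) g"
    if e: "e \<in> complement_edges hub_graph" for e and g :: "nat \<Rightarrow> nat"
  proof
    assume g: "good_partition (Suc h) (add_edge hub_graph e) g"
    obtain u v where "u < order" "v < order" "u \<noteq> v" "{u, v} \<notin> edges hub_graph" "e = {u, v}"
      using e unfolding complement_edges_def by auto
    then obtain u v where uv: "u < v" "v < order" "{u, v} \<notin> edges hub_graph" "e = {u, v}"
      using insert_commute by (metis linorder_neqE_nat)
    obtain w where w: "{u, w} \<in> edges hub_graph" "{v, w} \<in> edges hub_graph"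
      "label u \<noteq> label v" "label u \<noteq> label w" "label v \<noteq> label w"
      using nonedge_common_neighbour[OF uv(1-3)] by blast
    have "u < order" "w < order"
      using w(1) by (simp_all add: edge_hub_graph_iff)
    then have "g u \<noteq> g v" "g v \<noteq> g w" "g u \<noteq> g w"
      using good_partition_unique[OF g, of u v] good_partition_unique[OF g, of v w]
        good_partition_unique[OF g, of u w] w uv(2) by (auto simp: add_edge_def)
    then show False
      using g w uv(4) unfolding good_partition_def add_edge_def by simp blast
  qed
  then show ?thesis
    using simple_hub_graph good_partition_label h by (subst saturated_iff) auto
qed

section \<open>Edge count of the construction\<close>

text \<open>Each edge is counted at its larger end. The doubled summands stand for a complete core,
  the outer cliques (two terms), two hub edges per outer vertex, and \<open>h\<close> extra edges
  for the vertex \<open>2 * h\<close>.\<close>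

lemma card_edges_hub_graph:
  "2 * card (edges hub_graph) \<le>
     2 * h * (2 * h - 1) + q * (m * (m - 1)) + 2 * (r * m) + 4 * (q * m + r) + 2 * h"
proof -
  define P where "P v = {u. u < v \<and> (label u = label v \<or> cross u v)}" for v
  have fin: "finite (P v)" for v
    by (simp add: P_def)
  have "edges hub_graph \<subseteq> (\<Union>v<order. (\<lambda>u. {u, v}) ` P v)"
    by (auto simp: hub_graph_def P_def)
  then have "card (edges hub_graph) \<le> card (\<Union>v<order. (\<lambda>u. {u, v}) ` P v)"
    using fin by (intro card_mono) auto
  also have "\<dots> \<le> (\<Sum>v<order. card ((\<lambda>u. {u, v}) ` P v))"
    by (rule card_UN_le) simp
  also have "\<dots> \<le> (\<Sum>v<order. card (P v))"
    by (intro sum_mono card_image_le fin)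
  also have "\<dots> = (\<Sum>v<2 * h. card (P v)) + (\<Sum>v = 2 * h..<2 * h + (q * m + r). card (P v))"
    by (simp add: order_def sum.atLeastLessThan_concat lessThan_atLeast0)
  also have "(\<Sum>v = 2 * h..<2 * h + (q * m + r). card (P v)) = (\<Sum>j<q * m + r. card (P (2 * h + j)))"
    using sum.shift_bounds_nat_ivl[of "\<lambda>v. card (P v)" 0 "2 * h" "q * m + r"]
    by (simp add: lessThan_atLeast0 add.commute)
  finally have total: "card (edges hub_graph) \<le>
      (\<Sum>v<2 * h. card (P v)) + (\<Sum>j<q * m + r. card (P (2 * h + j)))" .
  have "card (P v) \<le> v" for v
    using card_mono[of "{..<v}" "P v"] by (auto simp: P_def)
  then have "(\<Sum>v<2 * h. card (P v)) \<le> (\<Sum>v<2 * h. v)"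
    by (intro sum_mono)
  \<comment> \<open>The sum of the first integers is the case \<open>q = 1\<close> of
    \<open>sum_div\<close>.\<close>
  moreover have "2 * (\<Sum>v<2 * h. v) = 2 * h * (2 * h - 1)"
    using sum_div[of 0 1 "2 * h"] by simp
  moreover have "card (P (2 * h + j)) \<le> j div q + 2 + (if j = 0 then h else 0)" for j
  proof -
    have "P (2 * h + j) \<subseteq> (+) (2 * h) ` {i. i < j \<and> i mod q = j mod q} \<union> (if j = 0 then {h..<2 * h} else {0, h})"
    proof
      fix u assume "u \<in> P (2 * h + j)"
      then have u: "u < 2 * h + j" "label u = label (2 * h + j) \<or> cross u (2 * h + j)"
        by (auto simp: P_def)
      show "u \<in> (+) (2 * h) ` {i. i < j \<and> i mod q = j mod q} \<union> (if j = 0 then {h..<2 * h} else {0, h})"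
      proof (cases "cross u (2 * h + j)")
        case True
        then show ?thesis
          using h by (auto simp: cross_def)
      next
        case False
        then have lab: "label u = label (2 * h + j)"
          using u(2) by simp
        then have "2 * h \<le> u"
          by (auto simp: label_def split: if_splits)
        then obtain i where i: "u = 2 * h + i"
          using le_Suc_ex by blast
        then have "i < j" "i mod q = j mod q"
          using u(1) lab by (simp_all add: label_def)
        then show ?thesis
          using i by blast
      qed
    qed
    then have "card (P (2 * h + j)) \<le>
        card ((+) (2 * h) ` {i. i < j \<and> i mod q = j mod q} \<union> (if j = 0 then {h..<2 * h} else {0, h}))"
      by (intro card_mono) auto
    also have "\<dots> \<le> card ((+) (2 * h) ` {i. i < j \<and> i mod q = j mod q}) + card (if j = 0 then {h..<2 * h} else {0, h})"
      by (rule card_Un_le)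
    also have "card ((+) (2 * h) ` {i. i < j \<and> i mod q = j mod q}) \<le> j div q"
      using card_residue_class_below[of j q] by (simp add: card_image)
    also have "card (if j = 0 then {h..<2 * h} else {0, h}) \<le> 2 + (if j = 0 then h else 0)"
      by (simp add: card_insert_if)
    finally show ?thesis
      by simp
  qed
  then have "(\<Sum>j<q * m + r. card (P (2 * h + j))) \<le> (\<Sum>j<q * m + r. j div q + 2 + (if j = 0 then h else 0))"
    by (intro sum_mono)
  moreover have "(\<Sum>j<q * m + r. if j = 0 then h else 0) \<le> h"
    by (simp add: sum.delta)
  moreover have "(\<Sum>j<q * m + r. 2) = 2 * (q * m + r)"
    by simp
  moreover have "2 * (\<Sum>j<q * m + r. j div q) = q * (m * (m - 1)) + 2 * (r * m)"
    using sum_div qr by simp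
  ultimately show ?thesis
    using total unfolding sum.distrib by linarith
qed

end

section \<open>Attaining the saturation number and matching the constants\<close>

text \<open>As \<open>sat\<close> is a \<open>LEAST\<close>, one saturated graph is needed to know
  that the minimum is attained. The construction supplies it, and the lower bound is then applied to
  an optimal graph.\<close>

lemma sat_witness:
  assumes "saturated \<F> (G :: nat graph)"
  shows "sat (card (verts G)) \<F> \<le> card (edges G)"
    and "\<exists>H :: nat graph. card (verts H) = card (verts G) \<and> saturated \<F> H \<and>
      card (edges H) = sat (card (verts G)) \<F>"
proof -
  let ?Q = "\<lambda>m. \<exists>H :: nat graph. card (verts H) = card (verts G) \<and> saturated \<F> H \<and> card (edges H) = m"
  have Q: "?Q (card (edges G))"
    using assms by blast
  show "sat (card (verts G)) \<F> \<le> card (edges G)"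
    unfolding sat_def by (rule Least_le[where P = ?Q, OF Q])
  show "?Q (sat (card (verts G)) \<F>)"
    unfolding sat_def by (rule LeastI[where P = ?Q, OF Q])
qed

theorem theorem1p5:
  fixes k n :: nat and c C :: real
  assumes "k \<ge> 5"
    and "int n \<ge> 2 * int k + (\<lceil>real k / 2\<rceil> + 1) * \<lceil>real k / 2\<rceil> - 2"
    and "c = (1/2 * of_int \<lceil>real k / 2\<rceil> + 3/2) * real k - 2"
    and "C = 2 * (real k)^2 - 6 * real k + 3/2
               - of_int \<lceil>real k / 2\<rceil> * (real k - 1/2 * of_int \<lceil>real k / 2\<rceil> - 1)"
  shows "(3/2 + 1/2 * of_int \<lceil>real k / 2\<rceil>) * real n - c
           \<le> real (sat n (R_min (complete_graph 3) (trees k)))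
       \<and> real (sat n (R_min (complete_graph 3) (trees k)))
           \<le> (3/2 + 1/2 * of_int \<lceil>real k / 2\<rceil>) * real n + C"
proof -
  define m where "m = (k + 1) div 2"
  have m: "2 * m \<le> k + 1" "k \<le> 2 * m" "3 \<le> m"
    using assms(1) by (auto simp: m_def)
  have "real (2 * m) \<le> real (k + 1)" "real k \<le> real (2 * m)"
    using m by (simp_all only: of_nat_le_iff)
  then have ceil: "\<lceil>real k / 2\<rceil> = int m"
    by (intro ceiling_unique) auto
  obtain h where kh: "k = Suc h" "4 \<le> h"
    using assms(1) by (cases k) auto
  have "int (2 * h + (m + 1) * m) \<le> int n"
    using assms(2) kh(1) unfolding ceil by (simp add: algebra_simps)
  then have n: "2 * h + (m + 1) * m \<le> n"
    by (simp only: of_nat_le_iff)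
  \<comment> \<open>The \<open>n - 2 * h\<close> outer vertices fill \<open>q\<close> cliques of
    size \<open>m\<close>, with \<open>r < m\<close> left over. The bound on \<open>n\<close> gives
    \<open>q > m > r\<close>, so each clique receives at most one extra vertex.\<close>
  define q where "q = (n - 2 * h) div m"
  define r where "r = (n - 2 * h) mod m"
  have "(m + 1) * m div m \<le> q"
    unfolding q_def using n by (intro div_le_mono) simp
  then have q: "m < q"
    using m by simp
  have r: "r < m"
    unfolding r_def using m by simp
  have n_eq: "n = 2 * h + (q * m + r)"
    using n unfolding q_def r_def by simp
  interpret hub_graph h m q r
    by unfold_locales (use kh m q r in auto)
  have card_n: "card (verts hub_graph) = n"
    by (simp add: order_def n_eq)
  let ?s = "sat n (R_min (complete_graph 3) (trees k))"
  have upper: "?s \<le> card (edges hub_graph)"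
    and "\<exists>G :: nat graph. card (verts G) = n \<and> saturated (R_min (complete_graph 3) (trees k)) G \<and>
      card (edges G) = ?s"
    using sat_witness[OF saturated_hub_graph] unfolding card_n kh(1)[symmetric] by blast+
  then obtain G :: "nat graph" where G: "card (verts G) = n"
    "saturated (R_min (complete_graph 3) (trees k)) G" "card (edges G) = ?s"
    by blast
  have nk: "k + 2 \<le> n"
    using n kh m by (simp add: algebra_simps)
  \<comment> \<open>Halving this yields exactly the constant \<open>c\<close>.\<close>
  have "(m + 3) * (n - k) + 4 \<le> 2 * ?s"
    using saturated_card_edges_ge[OF G(2) assms(1) m(1,2)] nk unfolding G by simp
  then have "real ((m + 3) * (n - k) + 4) \<le> real (2 * ?s)"
    by (simp only: of_nat_le_iff)
  then have low: "(real m + 3) * (real n - real k) + 4 \<le> 2 * real ?s"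
    using nk by (simp add: of_nat_diff)
  have "2 * ?s \<le> 2 * h * (2 * h - 1) + q * (m * (m - 1)) + 2 * (r * m) + 4 * (q * m + r) + 2 * h"
    using upper card_edges_hub_graph by linarith
  then have "real (2 * ?s) \<le> real (2 * h * (2 * h - 1) + q * (m * (m - 1)) + 2 * (r * m) + 4 * (q * m + r) + 2 * h)"
    by (simp only: of_nat_le_iff)
  then have up: "2 * real ?s \<le> 2 * real h * (2 * real h - 1) + real q * (real m * (real m - 1))
      + 2 * (real r * real m) + 4 * (real q * real m + real r) + 2 * real h"
    using kh m by (simp add: of_nat_diff)
  \<comment> \<open>After substituting \<open>q * m = n - 2 * h - r\<close>, the remainder
    contributes \<open>r * (m + 1) \<le> m^2 - 1\<close>, the source of the quadratic term in
    \<open>m\<close> in \<open>C\<close>. Comparing with \<open>C\<close> leaves a slack of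
    \<open>h - 2\<close>.\<close>
  have "real r * (real m + 1) \<le> (real m - 1) * (real m + 1)"
    using r by (intro mult_right_mono) auto
  moreover have "real n = 2 * real h + (real q * real m + real r)" "real k = real h + 1"
    using n_eq kh by simp_all
  ultimately have "2 * real ?s \<le> 2 * ((3/2 + 1/2 * real m) * real n + C)"
    using up kh(2) unfolding assms(4) ceil by (simp add: algebra_simps power2_eq_square)
  moreover have "(3/2 + 1/2 * real m) * real n - c \<le> real ?s"
    using low unfolding assms(3) ceil by (simp add: algebra_simps)
  ultimately show ?thesis
    unfolding ceil by simp
qed

end
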